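(* Let $\mathcal{G}$ be the family of $3$-regular simple graphs of order $10$ (up to isomorphism), and let $P$ be the Petersen graph. Then: (i) $P$ is not $\mathcal{E}$-unique (and not $\mathcal{RE}$-unique) in $\mathcal{G}$; in fact $E(P)=16$ and there is a graph in $\mathcal{G}$ non-isomorphic to $P$ with energy $16$. (ii) $P$ has maximum energy (and maximum Randić energy) in $\mathcal{G}$: $E(G)\le E(P)$ and $RE(G)\le RE(P)$ for all $G\in\mathcal{G}$. (iii) $P$ is identified in $\mathcal{G}$ by its energy and its eigenvalues: $P$ is the only graph in $\mathcal{G}$ with energy $E(P)$ and adjacency spectrum equal to that of $P$ (namely $3$ with multiplicity $1$, $1$ with multiplicity $5$, $-2$ with multiplicity $4$); the same holds with Randić energy in place of energy.
   Context: All graphs are finite, simple, undirected, without loops. For a graph $G$ with adjacency eigenvalues $\lambda_1,\dots,\lambda_n$, the energy is $E(G)=\sum_i|\lambda_i|$. The Randić matrix $R(G)$ has $(i,j)$-entry $1/\sqrt{d_id_j}$ if $v_i\sim v_j$ and $0$ otherwise ($d_i$ the degree of $v_i$); the Randić energy $RE(G)$ is the sum of the absolute values of the eigenvalues of $R(G)$. A graph $G$ in a family $\mathcal{F}$ is $\mathcal{E}$-unique (resp. $\mathcal{RE}$-unique) in $\mathcal{F}$ if no graph of $\mathcal{F}$ non-isomorphic to $G$ has the same energy (resp. Randić energy) as $G$. *)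

theory Defs
  imports
    "Graph_Theory.Pair_Digraph"
    "Graph_Theory.Digraph_Isomorphism"
    "Jordan_Normal_Form.Char_Poly"
    "HOL-Computational_Algebra.Fundamental_Theorem_Algebra"
    Complex_Main
begin

text \<open>
  Finite simple undirected graphs are the library's \<open>pair_graph\<close>s: a finite vertex set together
  with a symmetric, irreflexive set of ordered pairs, so each edge contributes two arcs.  Hence
  the degree of a vertex is its out-degree, and two graphs are isomorphic iff they are so as
  digraphs.
\<close>

text \<open>
  The list of vertices in increasing order indexes rows and columns; another enumeration would
  change the matrices below only by a simultaneous permutation of rows and columns.
\<close>

definition vertex_list :: "'v :: linorder pair_pre_digraph \<Rightarrow> 'v list" where
  "vertex_list G = sorted_list_of_set (pverts G)"

definition adjacency_matrix :: "'v :: linorder pair_pre_digraph \<Rightarrow> real mat" where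
  "adjacency_matrix G = mat (card (pverts G)) (card (pverts G))
     (\<lambda>(i, j). if (vertex_list G ! i, vertex_list G ! j) \<in> parcs G then 1 else 0)"

definition randic_matrix :: "'v :: linorder pair_pre_digraph \<Rightarrow> real mat" where
  "randic_matrix G = mat (card (pverts G)) (card (pverts G))
     (\<lambda>(i, j). if (vertex_list G ! i, vertex_list G ! j) \<in> parcs G
       then 1 / sqrt (real (out_degree (with_proj G) (vertex_list G ! i)) *
                      real (out_degree (with_proj G) (vertex_list G ! j)))
       else 0)"

text \<open>
  Real eigenvalues with algebraic multiplicity.  It is only applied to real symmetric matrices,
  for which these are all the eigenvalues.
\<close>

definition eigenvalue_mset :: "real mat \<Rightarrow> real multiset" where
  "eigenvalue_mset A = proots (char_poly A)"

definition adjacency_spectrum :: "'v :: linorder pair_pre_digraph \<Rightarrow> real multiset" where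
  "adjacency_spectrum G = eigenvalue_mset (adjacency_matrix G)"

definition energy :: "'v :: linorder pair_pre_digraph \<Rightarrow> real" where
  "energy G = (\<Sum>x\<in>#adjacency_spectrum G. \<bar>x\<bar>)"

definition randic_energy :: "'v :: linorder pair_pre_digraph \<Rightarrow> real" where
  "randic_energy G = (\<Sum>x\<in>#eigenvalue_mset (randic_matrix G). \<bar>x\<bar>)"

definition regular_graphs :: "nat \<Rightarrow> nat \<Rightarrow> 'v pair_pre_digraph set" where
  "regular_graphs k n =
     {G. pair_graph G \<and> card (pverts G) = n \<and> (\<forall>v\<in>pverts G. out_degree (with_proj G) v = k)}"

text \<open>Every finite graph is isomorphic to one whose vertices are natural numbers.\<close>

definition cubic_graphs_10 :: "nat pair_pre_digraph set" where
  "cubic_graphs_10 = regular_graphs 3 10"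

definition energy_unique ::
    "'v :: linorder pair_pre_digraph set \<Rightarrow> 'v pair_pre_digraph \<Rightarrow> bool" where
  "energy_unique F G \<longleftrightarrow> \<not> (\<exists>H\<in>F. \<not> digraph_iso (with_proj G) (with_proj H) \<and> energy H = energy G)"

definition randic_energy_unique ::
    "'v :: linorder pair_pre_digraph set \<Rightarrow> 'v pair_pre_digraph \<Rightarrow> bool" where
  "randic_energy_unique F G \<longleftrightarrow>
     \<not> (\<exists>H\<in>F. \<not> digraph_iso (with_proj G) (with_proj H) \<and> randic_energy H = randic_energy G)"

text \<open>
  The outer cycle is \<open>0, \<dots>, 4\<close>, the inner pentagram is \<open>5, \<dots>, 9\<close>, and the spokes join \<open>i\<close>
  to \<open>i + 5\<close>.
\<close>

definition petersen_edges :: "(nat \<times> nat) set" where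
  "petersen_edges =
     (\<lambda>i. (i, (i + 1) mod 5)) ` {0..<5} \<union>
     (\<lambda>i. (i, i + 5)) ` {0..<5} \<union>
     (\<lambda>i. (i + 5, (i + 2) mod 5 + 5)) ` {0..<5}"

definition petersen :: "nat pair_pre_digraph" where
  "petersen = \<lparr> pverts = {0..<10}, parcs = petersen_edges \<union> petersen_edges\<inverse> \<rparr>"

end

(*
  Write A for the adjacency matrix and d = A^2.  Its off-diagonal entries are codegrees, and
  tr A^4 = 150 + w where w is 8 times the number of 4-cycles.  With N = J - (A^2 - 2I), whose rows sum
  to 3, one finds tr A^6 = 990 + 6w - tr N^3.  If there is no 4-cycle, N is the adjacency matrix of a
  cubic graph, so tr N^3 >= 0; with one or two 4-cycles -tr N^3 stays small.  The even sextic that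
  touches |u| at 1 and 2 (or at 5/4 and 5/2) then bounds the energy through these traces, and with
  three or more 4-cycles tr A^4 alone suffices, through an even quartic dominating |u| on [-3,3].
  The eigenvalue 3 is always set aside.

  The spectrum of the Petersen graph forces tr A^3 = 0 and w = 0, i.e. girth at least 5; a cubic graph
  on 10 vertices with girth at least 5 has diameter 2, which determines it from any of its 5-cycles.
*)
theory Submission
  imports Defs "Jordan_Normal_Form.Schur_Decomposition"
begin

section \<open>Traces and eigenvalues of real symmetric matrices\<close>

text \<open>No list of the cubic graphs is drawn up: the bound is a linear-programming bound into
  which only traces enter. Contact at 1 and 2 is forced by sharpness. Apart from one 3, both
  explicit graphs of energy 16 have all eigenvalues in {-2, -1, 1, 2}, so an even polynomial that
  dominates |u| and gives exactly 13 on the other nine must meet |u| there. This leaves no slack: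
  the sextic yields 13 - w/18 - tr N^3/108, and already one 4-cycle is too much for the available
  bound on -tr N^3. Moving the contact points outward lowers the weight of tr A^6, at the cost of a
  sharpness that is only wanted without 4-cycles. The Randic claims reduce to the others, since the
  Randic matrix of a cubic graph is A/3.\<close>

definition mat_trace :: "'a :: comm_monoid_add mat \<Rightarrow> 'a" where
  "mat_trace A = (\<Sum>i<dim_row A. A $$ (i, i))"

lemma index_mat_mult_sum:
  assumes "A \<in> carrier_mat n n" "B \<in> carrier_mat n n" "i < n" "j < n"
  shows "(A * B) $$ (i, j) = (\<Sum>k<n. A $$ (i, k) * B $$ (k, j))"
  using assms by (auto simp: scalar_prod_def atLeast0LessThan)

lemma mat_trace_mult:
  assumes "A \<in> carrier_mat n n" "B \<in> carrier_mat n n"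
  shows "mat_trace (A * B) = (\<Sum>i<n. \<Sum>j<n. A $$ (i, j) * B $$ (j, i))"
  using assms unfolding mat_trace_def by (auto simp: scalar_prod_def atLeast0LessThan)

lemma mat_trace_comm:
  fixes A B :: "'a :: comm_ring mat"
  assumes "A \<in> carrier_mat n n" "B \<in> carrier_mat n n"
  shows "mat_trace (A * B) = mat_trace (B * A)"
  unfolding mat_trace_mult[OF assms] mat_trace_mult[OF assms(2,1)]
  by (subst sum.swap) (simp add: mult.commute)

lemma mat_trace_similar:
  fixes A B :: "'a :: comm_ring_1 mat"
  assumes "similar_mat_wit A B P Q"
  shows "mat_trace A = mat_trace B"
proof -
  define n where "n = dim_row A"
  note w = similar_mat_witD[OF n_def assms]
  have "mat_trace A = mat_trace (P * (B * Q))"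
    using w by (simp add: assoc_mult_mat[of _ n n _ n _ n])
  also have "\<dots> = mat_trace (B * (Q * P))"
    using w by (subst mat_trace_comm[of _ n]) (auto simp: assoc_mult_mat[of _ n n _ n _ n])
  finally show ?thesis using w by simp
qed

text \<open>A trace sees only the diagonal, but the zeros below it keep the induction going: for
  \<open>j\<close> at most \<open>i\<close>, the terms with \<open>l < i\<close> vanish by induction
  and those with \<open>l > i\<close> by triangularity of \<open>T\<close>.\<close>

lemma upper_triangular_pow:
  fixes T :: "'a :: comm_ring_1 mat"
  assumes T: "T \<in> carrier_mat n n" "upper_triangular T"
  shows "i < n \<Longrightarrow> j \<le> i \<Longrightarrow> (T ^\<^sub>m k) $$ (i, j) = (if i = j then (T $$ (i, i)) ^ k else 0)"
proof (induction k arbitrary: i j)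
  case 0
  then show ?case using T by auto
next
  case (Suc k)
  have "(T ^\<^sub>m Suc k) $$ (i, j) = (\<Sum>l<n. (T ^\<^sub>m k) $$ (i, l) * T $$ (l, j))"
    using T Suc.prems by (simp add: index_mat_mult_sum[of _ n] del: index_mult_mat)
  also have "\<dots> = (\<Sum>l<n. if l = i then (T $$ (i, i)) ^ k * T $$ (i, j) else 0)"
  proof (rule sum.cong[OF refl])
    fix l assume "l \<in> {..<n}"
    then show "(T ^\<^sub>m k) $$ (i, l) * T $$ (l, j)
        = (if l = i then (T $$ (i, i)) ^ k * T $$ (i, j) else 0)"
      using Suc.IH[of i l] Suc.prems upper_triangularD[OF T(2), of j l] T(1)
      by (cases l i rule: linorder_cases) auto
  qed
  also have "\<dots> = (T $$ (i, i)) ^ k * T $$ (i, j)"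
    using Suc.prems by simp
  finally show ?case
    using Suc.prems upper_triangularD[OF T(2), of j i] T(1) by auto
qed

text \<open>A Schur decomposition gives a triangular matrix with diagonal \<open>es\<close>. This
  turns counts of closed walks into power sums of eigenvalues.\<close>

lemma mat_trace_pow:
  fixes A :: "real mat"
  assumes A: "A \<in> carrier_mat n n" and es: "char_poly A = (\<Prod>e\<leftarrow>es. [:- e, 1:])"
  shows "mat_trace (A ^\<^sub>m k) = (\<Sum>e\<leftarrow>es. e ^ k)"
proof -
  obtain T P Q where schur: "schur_decomposition A es = (T, P, Q)"
    by (cases "schur_decomposition A es") auto
  have sim: "similar_mat_wit A T P Q" and ut: "upper_triangular T" and diag: "diag_mat T = es"
    using schur_decomposition[OF A es schur] by auto
  have T: "T \<in> carrier_mat n n"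
    using similar_mat_witD2[OF A sim] by auto
  have "mat_trace (A ^\<^sub>m k) = mat_trace (T ^\<^sub>m k)"
    using similar_mat_wit_pow[OF sim] by (rule mat_trace_similar)
  also have "\<dots> = (\<Sum>i<n. (T $$ (i, i)) ^ k)"
    using T upper_triangular_pow[OF T ut] by (simp add: mat_trace_def)
  also have "\<dots> = (\<Sum>e\<leftarrow>es. e ^ k)"
    using T by (simp add: diag[symmetric] diag_mat_def interv_sum_list_conv_sum_set_nat
        atLeast0LessThan o_def)
  finally show ?thesis .
qed

section \<open>Reality and splitting of the spectrum of a symmetric matrix\<close>

lemma nonzero_vecE:
  assumes "v \<in> carrier_vec n" "v \<noteq> 0\<^sub>v n"
  obtains i where "i < n" "v $ i \<noteq> 0"
proof -
  have "v = 0\<^sub>v n" if "\<forall>i<n. v $ i = 0"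
    using that assms(1) by (intro eq_vecI) auto
  with assms(2) that show thesis by blast
qed

text \<open>The Hermitian form \<open>r\<close> of an eigenvector is \<open>z\<close> times its
  squared norm \<open>s\<close>, and symmetry of the real matrix makes \<open>r\<close> equal to its
  conjugate.\<close>

lemma symmetric_mat_eigenvalue_real:
  fixes A :: "real mat"
  assumes A: "A \<in> carrier_mat n n" and sym: "\<And>i j. i < n \<Longrightarrow> j < n \<Longrightarrow> A $$ (i, j) = A $$ (j, i)"
    and ev: "eigenvalue (map_mat complex_of_real A) z"
  shows "z \<in> \<real>"
proof -
  let ?A = "map_mat complex_of_real A"
  obtain v where v: "v \<in> carrier_vec n" "v \<noteq> 0\<^sub>v n" and Av: "?A *\<^sub>v v = z \<cdot>\<^sub>v v"
    using ev A unfolding eigenvalue_def eigenvector_def by auto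
  have row: "(\<Sum>j<n. of_real (A $$ (i, j)) * v $ j) = z * v $ i" if "i < n" for i
    using arg_cong[OF Av, of "\<lambda>w. w $ i"] that v A
    by (simp add: scalar_prod_def atLeast0LessThan)
  define s where "s = (\<Sum>i<n. (cmod (v $ i))\<^sup>2)"
  have s: "complex_of_real s = (\<Sum>i<n. v $ i * cnj (v $ i))"
    by (simp add: s_def complex_norm_square del: of_real_power)
  define r where "r = (\<Sum>i<n. \<Sum>j<n. of_real (A $$ (i, j)) * v $ j * cnj (v $ i))"
  have r: "r = z * s"
    unfolding r_def s sum_distrib_left
    by (intro sum.cong refl) (simp add: sum_distrib_right[symmetric] row)
  have "cnj r = (\<Sum>i<n. \<Sum>j<n. of_real (A $$ (i, j)) * cnj (v $ j) * v $ i)"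
    by (simp add: r_def)
  also have "\<dots> = (\<Sum>i<n. \<Sum>j<n. of_real (A $$ (j, i)) * v $ j * cnj (v $ i))"
    by (subst sum.swap) (simp add: mult_ac)
  also have "\<dots> = r"
    unfolding r_def using sym by (intro sum.cong refl) simp
  finally have "cnj z * s = z * s"
    by (simp add: r)
  moreover have "s \<noteq> 0"
  proof -
    obtain i where "i < n" "v $ i \<noteq> 0"
      using nonzero_vecE[OF v] by blast
    then have "s > 0"
      unfolding s_def by (intro sum_pos2[of _ i]) auto
    then show ?thesis by simp
  qed
  ultimately show ?thesis
    by (simp add: Reals_cnj_iff)
qed

text \<open>Over the complex numbers the polynomial factors; its roots being real, this
  factorization is the image of a real one under an injective map of polynomials.\<close>

lemma symmetric_mat_char_poly_splits:
  fixes A :: "real mat"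
  assumes A: "A \<in> carrier_mat n n" and sym: "\<And>i j. i < n \<Longrightarrow> j < n \<Longrightarrow> A $$ (i, j) = A $$ (j, i)"
  obtains es where "char_poly A = (\<Prod>e\<leftarrow>es. [:- e, 1:])" "length es = n"
proof -
  let ?A = "map_mat complex_of_real A"
  have cA: "?A \<in> carrier_mat n n" using A by simp
  obtain as where as: "char_poly ?A = (\<Prod>a\<leftarrow>as. [:- a, 1:])" "length as = n"
    using char_poly_factorized[OF cA] by auto
  have real: "a \<in> \<real>" if "a \<in> set as" for a
  proof (rule symmetric_mat_eigenvalue_real[OF A sym])
    show "eigenvalue ?A a"
      unfolding eigenvalue_root_char_poly[OF cA] as poly_prod_list
      using that by (simp add: prod_list_zero_iff)
  qed auto
  define es where "es = map Re as"
  interpret inj_comm_ring_hom complex_of_real ..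
  interpret P: map_poly_inj_idom_hom complex_of_real ..
  have "map_poly complex_of_real (char_poly A) = (\<Prod>a\<leftarrow>as. [:- a, 1:])"
    unfolding as(1)[symmetric] of_real_hom.char_poly_hom[OF A] ..
  also have "\<dots> = map_poly complex_of_real (\<Prod>e\<leftarrow>es. [:- e, 1:])"
    using real by (auto simp: es_def o_def P.hom_prod_list intro!: arg_cong[where f = prod_list])
  finally have "char_poly A = (\<Prod>e\<leftarrow>es. [:- e, 1:])"
    by simp
  then show ?thesis
    using as(2) by (intro that[of es]) (auto simp: es_def)
qed

lemma proots_linear_factors: "proots (\<Prod>e\<leftarrow>es. [:- e, 1:]) = mset es"
  for es :: "'a :: idom list"
proof (induction es)
  case (Cons e es)
  have "(\<Prod>e\<leftarrow>es. [:- e, 1:]) \<noteq> 0"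
    by (auto simp: prod_list_zero_iff)
  then have "proots (\<Prod>e\<leftarrow>e # es. [:- e, 1:]) = proots [:- e, 1:] + proots (\<Prod>e\<leftarrow>es. [:- e, 1:])"
    by (simp only: list.map prod_list.Cons) (rule proots_mult; simp)
  then show ?case by (simp add: Cons)
qed simp

lemma char_poly_smult_splits:
  fixes A :: "real mat"
  assumes A: "A \<in> carrier_mat n n" and es: "char_poly A = (\<Prod>e\<leftarrow>es. [:- e, 1:])"
  shows "char_poly (c \<cdot>\<^sub>m A) = (\<Prod>e\<leftarrow>es. [:- (c * e), 1:])"
proof -
  obtain T P Q where schur: "schur_decomposition A es = (T, P, Q)"
    by (cases "schur_decomposition A es") auto
  have sim: "similar_mat_wit A T P Q" and ut: "upper_triangular T" and diag: "diag_mat T = es"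
    using schur_decomposition[OF A es schur] by auto
  have T: "T \<in> carrier_mat n n"
    using similar_mat_witD2[OF A sim] by auto
  have "char_poly (c \<cdot>\<^sub>m A) = char_poly (c \<cdot>\<^sub>m T)"
    using similar_mat_wit_smult[OF sim] by (intro char_poly_similar) (auto simp: similar_mat_def)
  also have "\<dots> = (\<Prod>e\<leftarrow>diag_mat (c \<cdot>\<^sub>m T). [:- e, 1:])"
    using T ut by (intro char_poly_upper_triangular[of _ n]) (auto simp: upper_triangular_def)
  also have "diag_mat (c \<cdot>\<^sub>m T) = map (\<lambda>e. c * e) es"
    using T by (auto simp: diag[symmetric] diag_mat_def)
  finally show ?thesis by (simp add: o_def)
qed

text \<open>The eigenvalue equation is read in a coordinate where the eigenvector attains its
  maximal absolute value \<open>M\<close>.\<close>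

lemma eigenvalue_abs_le:
  fixes A :: "real mat"
  assumes A: "A \<in> carrier_mat n n" and rows: "\<And>i. i < n \<Longrightarrow> (\<Sum>j<n. \<bar>A $$ (i, j)\<bar>) \<le> d"
    and ev: "eigenvalue A e"
  shows "\<bar>e\<bar> \<le> d"
proof -
  obtain v where v: "v \<in> carrier_vec n" "v \<noteq> 0\<^sub>v n" and Av: "A *\<^sub>v v = e \<cdot>\<^sub>v v"
    using ev A unfolding eigenvalue_def eigenvector_def by auto
  obtain k where k: "k < n" "v $ k \<noteq> 0"
    using nonzero_vecE[OF v] by blast
  define M where "M = Max ((\<lambda>i. \<bar>v $ i\<bar>) ` {..<n})"
  have le: "\<bar>v $ i\<bar> \<le> M" if "i < n" for i
    unfolding M_def using that by (intro Max_ge) auto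
  have "M \<in> (\<lambda>i. \<bar>v $ i\<bar>) ` {..<n}"
    unfolding M_def using k by (intro Max_in) auto
  then obtain i where i: "i < n" "\<bar>v $ i\<bar> = M" by auto
  have "M > 0" using le[OF k(1)] k(2) by linarith
  have "e * v $ i = (\<Sum>j<n. A $$ (i, j) * v $ j)"
    using arg_cong[OF Av, of "\<lambda>w. w $ i"] i(1) v A
    by (simp add: scalar_prod_def atLeast0LessThan)
  then have "\<bar>e\<bar> * M \<le> (\<Sum>j<n. \<bar>A $$ (i, j)\<bar> * \<bar>v $ j\<bar>)"
    using sum_abs[of "\<lambda>j. A $$ (i, j) * v $ j" "{..<n}"] i(2) by (simp add: abs_mult flip: i(2))
  also have "\<dots> \<le> (\<Sum>j<n. \<bar>A $$ (i, j)\<bar> * M)"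
    using le by (intro sum_mono mult_left_mono) auto
  also have "\<dots> \<le> d * M"
    using rows[OF i(1)] \<open>M > 0\<close> by (simp add: sum_distrib_right[symmetric])
  finally show ?thesis using \<open>M > 0\<close> by simp
qed

lemma eigenvalue_row_sum:
  fixes A :: "real mat"
  assumes A: "A \<in> carrier_mat n n" and rows: "\<And>i. i < n \<Longrightarrow> (\<Sum>j<n. A $$ (i, j)) = d" and "n > 0"
  shows "eigenvalue A d"
proof -
  have "A *\<^sub>v vec n (\<lambda>_. 1) = d \<cdot>\<^sub>v vec n (\<lambda>_. 1)"
    using A rows by (intro eq_vecI) (auto simp: scalar_prod_def atLeast0LessThan)
  moreover have "vec n (\<lambda>_. 1) \<noteq> (0\<^sub>v n :: real vec)"
    using \<open>n > 0\<close> by (auto dest: arg_cong[of _ _ "\<lambda>w. w $ 0"])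
  ultimately show ?thesis
    using A unfolding eigenvalue_def eigenvector_def by (intro exI[of _ "vec n (\<lambda>_. 1)"]) auto
qed

lemma eigenvalue_linear_factors:
  fixes A :: "real mat"
  assumes "A \<in> carrier_mat n n" "char_poly A = (\<Prod>e\<leftarrow>es. [:- e, 1:])"
  shows "eigenvalue A e \<longleftrightarrow> e \<in> set es"
  unfolding eigenvalue_root_char_poly[OF assms(1)] assms(2) poly_prod_list
  by (force simp: prod_list_zero_iff)

section \<open>Closed walks in cubic graphs on ten vertices\<close>

text \<open>\<open>f\<close> pairs the elements satisfying \<open>P\<close> with the others. Three
  uses produce the factor 8 in \<open>w_dvd\<close>.\<close>

lemma card_involution_half:
  assumes "finite S" and f: "\<And>z. z \<in> S \<Longrightarrow> f z \<in> S" "\<And>z. z \<in> S \<Longrightarrow> f (f z) = z"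
    and P: "\<And>z. z \<in> S \<Longrightarrow> P (f z) \<longleftrightarrow> \<not> P z"
  shows "card S = 2 * card {z \<in> S. P z}"
proof -
  have "bij_betw f {z \<in> S. P z} {z \<in> S. \<not> P z}"
    using f P by (intro bij_betw_byWitness[of _ f]) auto
  then have "card {z \<in> S. P z} = card {z \<in> S. \<not> P z}"
    by (rule bij_betw_same_card)
  moreover have "card S = card {z \<in> S. P z} + card {z \<in> S. \<not> P z}"
    using \<open>finite S\<close> by (subst card_Un_disjoint[symmetric]) (auto intro: arg_cong[of _ _ card])
  ultimately show ?thesis by simp
qed

lemma double_sum_nonneg_eq_0_iff:
  fixes f :: "nat \<Rightarrow> nat \<Rightarrow> real"
  assumes "\<And>i j. i < n \<Longrightarrow> j < n \<Longrightarrow> 0 \<le> f i j"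
  shows "(\<Sum>i<n. \<Sum>j<n. f i j) = 0 \<longleftrightarrow> (\<forall>i<n. \<forall>j<n. f i j = 0)"
  unfolding sum.cartesian_product using assms by (subst sum_nonneg_eq_0_iff) auto

locale cubic10 =
  fixes a :: "nat \<Rightarrow> nat \<Rightarrow> real"
  assumes zero_one: "i < 10 \<Longrightarrow> j < 10 \<Longrightarrow> a i j = 0 \<or> a i j = 1"
    and sym: "i < 10 \<Longrightarrow> j < 10 \<Longrightarrow> a i j = a j i"
    and loopless: "i < 10 \<Longrightarrow> a i i = 0"
    and cubic: "i < 10 \<Longrightarrow> (\<Sum>j<10. a i j) = 3"
begin

definition nbrs :: "nat \<Rightarrow> nat set" where
  "nbrs i = {j. j < 10 \<and> a i j = 1}"

definition d :: "nat \<Rightarrow> nat \<Rightarrow> real" where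
  "d i j = (\<Sum>k<10. a i k * a k j)"

text \<open>Eight times the number of 4-cycles, by \<open>w_offdiag\<close> below.\<close>

definition w :: real where
  "w = (\<Sum>i<10. \<Sum>j<10. (d i j)\<^sup>2) - 150"

text \<open>
  \<open>x = d - 2 I\<close> is the matrix of codegrees with ones on the diagonal.  The signed matrix \<open>J - x\<close>
  splits into its positive part \<open>p\<close> and its negative part \<open>q\<close>; see \<open>one_minus_x\<close>.
\<close>

definition x :: "nat \<Rightarrow> nat \<Rightarrow> real" where
  "x i j = d i j - (if i = j then 2 else 0)"

definition p :: "nat \<Rightarrow> nat \<Rightarrow> real" where
  "p i j = (if d i j = 0 then 1 else 0)"

definition q :: "nat \<Rightarrow> nat \<Rightarrow> real" where
  "q i j = (if i = j then 0 else max 0 (d i j - 1))"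

definition n :: "nat \<Rightarrow> real" where
  "n i = (\<Sum>j<10. q i j)"

definition m :: real where
  "m = (\<Sum>i<10. n i)"

section \<open>Codegrees and 4-cycles\<close>

lemma finite_nbrs [simp]: "finite (nbrs i)"
  by (simp add: nbrs_def)

lemma card_nbrs: "i < 10 \<Longrightarrow> card (nbrs i) = 3"
proof -
  assume i: "i < 10"
  have "real (card (nbrs i)) = (\<Sum>j\<in>{..<10} \<inter> {j. a i j = 1}. 1)"
    by (simp add: nbrs_def Int_def)
  also have "\<dots> = (\<Sum>j<10. a i j)"
    by (subst sum.inter_restrict) (auto intro!: sum.cong dest: zero_one[OF i])
  finally show ?thesis using cubic[OF i] by simp
qed

lemma d_eq_card:
  assumes "i < 10" "j < 10"
  shows "d i j = card (nbrs i \<inter> nbrs j)"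
proof -
  have "real (card (nbrs i \<inter> nbrs j)) = (\<Sum>k\<in>{..<10} \<inter> {k. a i k = 1 \<and> a j k = 1}. 1)"
    by (auto simp: nbrs_def Int_def intro: arg_cong[of _ _ card])
  also have "\<dots> = (\<Sum>k<10. a i k * a j k)"
    by (subst sum.inter_restrict)
      (auto intro!: sum.cong dest: zero_one[OF assms(1)] zero_one[OF assms(2)])
  also have "\<dots> = d i j"
    unfolding d_def using assms by (intro sum.cong refl) (simp add: sym)
  finally show ?thesis ..
qed

lemma d_sym: "i < 10 \<Longrightarrow> j < 10 \<Longrightarrow> d i j = d j i"
  by (simp add: d_eq_card Int_commute)

lemma d_diag: "i < 10 \<Longrightarrow> d i i = 3"
  by (simp add: d_eq_card card_nbrs)

lemma d_row: 
  assumes "i < 10" shows "(\<Sum>j<10. d i j) = 9"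
proof -
  have "(\<Sum>j<10. d i j) = (\<Sum>k<10. a i k * (\<Sum>j<10. a k j))"
    unfolding d_def sum_distrib_left by (rule sum.swap)
  also have "\<dots> = 9"
    using cubic assms by (simp add: sum_distrib_right[symmetric])
  finally show ?thesis .
qed

lemma d_cases:
  assumes "i < 10" "j < 10"
  shows "d i j = 0 \<or> d i j = 1 \<or> d i j = 2 \<or> d i j = 3"
proof -
  define c where "c = card (nbrs i \<inter> nbrs j)"
  have "c \<le> 3"
    unfolding c_def using card_mono[of "nbrs i" "nbrs i \<inter> nbrs j"] card_nbrs[OF assms(1)] by simp
  then have "c \<in> {0, 1, 2, 3}" by auto
  then show ?thesis unfolding d_eq_card[OF assms] c_def[symmetric] by auto
qed

text \<open>Of the 150 subtracted in \<open>w\<close>, 90 is the diagonal part of the squares and 60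
  the off-diagonal sum of \<open>d\<close>, 6 in each row. What remains counts ordered pairs of
  distinct common neighbours.\<close>

lemma w_offdiag: "w = (\<Sum>i<10. \<Sum>j<10. if i = j then 0 else d i j * (d i j - 1))"
proof -
  have "(\<Sum>i<10. \<Sum>j<10. if i = j then 0 else d i j * (d i j - 1))
      = (\<Sum>i<10. \<Sum>j<10. (d i j)\<^sup>2 - d i j - (if i = j then 6 else 0))"
    by (intro sum.cong refl) (auto simp: d_diag power2_eq_square algebra_simps)
  also have "\<dots> = (\<Sum>i<10. \<Sum>j<10. (d i j)\<^sup>2) - (\<Sum>i<10. \<Sum>j<10. d i j) - (\<Sum>i<10::nat. 6)"
    by (simp add: sum_subtractf)
  also have "\<dots> = w"
    by (simp add: w_def d_row)
  finally show ?thesis ..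
qed

lemma w_eq_0_iff: "w = 0 \<longleftrightarrow> (\<forall>i<10. \<forall>j<10. i \<noteq> j \<longrightarrow> d i j \<le> 1)"
proof -
  have nonneg: "0 \<le> (if i = j then 0 else d i j * (d i j - 1))"
    and zero: "(if i = j then 0 else d i j * (d i j - 1)) = 0 \<longleftrightarrow> (i \<noteq> j \<longrightarrow> d i j \<le> 1)"
    if "i < 10" "j < 10" for i j
    using d_cases[OF that] by auto
  have "w = 0 \<longleftrightarrow> (\<forall>i<10. \<forall>j<10. (if i = j then 0 else d i j * (d i j - 1)) = 0)"
    unfolding w_offdiag using nonneg by (rule double_sum_nonneg_eq_0_iff)
  then show ?thesis using zero by auto
qed

lemma trace3_eq_0_iff:
  "(\<Sum>i<10. \<Sum>j<10. d i j * a j i) = 0 \<longleftrightarrow> (\<forall>i<10. \<forall>j<10. a i j = 1 \<longrightarrow> d i j = 0)"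
proof -
  have nonneg: "0 \<le> d i j * a j i" and zero: "d i j * a j i = 0 \<longleftrightarrow> (a i j = 1 \<longrightarrow> d i j = 0)"
    if "i < 10" "j < 10" for i j
    using d_cases[OF that] zero_one[OF that] sym[OF that] by auto
  have "(\<Sum>i<10. \<Sum>j<10. d i j * a j i) = 0 \<longleftrightarrow> (\<forall>i<10. \<forall>j<10. d i j * a j i = 0)"
    using nonneg by (rule double_sum_nonneg_eq_0_iff)
  then show ?thesis using zero by auto
qed

text \<open>A 4-cycle \<open>i k j l\<close> is counted once for each order of its diagonals \<open>(i, j)\<close>, \<open>(k, l)\<close> and each
  order of their endpoints.\<close>

lemma w_dvd: "\<exists>t::nat. w = 8 * real t"
proof -
  define I where "I = {(i, j). i < (10::nat) \<and> j < (10::nat) \<and> i \<noteq> j}"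
  define C where "C i j = nbrs i \<inter> nbrs j" for i j
  define W where "W = (SIGMA (i, j):I. {(k, l). k \<in> C i j \<and> l \<in> C i j \<and> k \<noteq> l})"
  have finI: "finite I"
    by (rule finite_subset[of _ "{..<10} \<times> {..<10}"]) (auto simp: I_def)
  have pairs: "{(k, l). k \<in> A \<and> l \<in> A \<and> k \<noteq> l} = A \<times> A - (\<lambda>k. (k, k)) ` A" for A :: "nat set"
    by auto
  have card_pairs: "real (card {(k, l). k \<in> A \<and> l \<in> A \<and> k \<noteq> l}) = real (card A) * (real (card A) - 1)"
    if "finite A" for A :: "nat set"
  proof -
    have "card ((\<lambda>k. (k, k)) ` A) = card A"
      by (intro card_image inj_onI) auto
    then show ?thesis
      unfolding pairs using that
      by (subst card_Diff_subset) (auto simp: algebra_simps of_nat_diff)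
  qed
  have finC: "finite (C i j)" for i j by (simp add: C_def)
  have fin2: "finite {(k, l). k \<in> C i j \<and> l \<in> C i j \<and> k \<noteq> l}" for i j
    unfolding pairs using finC by auto
  have finW: "finite W"
    unfolding W_def using finI fin2 by auto
  have dC: "real (card (C i j)) = d i j" if "i < 10" "j < 10" for i j
    by (simp add: C_def d_eq_card that)
  have "real (card W) = (\<Sum>(i, j)\<in>I. real (card {(k, l). k \<in> C i j \<and> l \<in> C i j \<and> k \<noteq> l}))"
    unfolding W_def using finI fin2 by (subst card_SigmaI) (auto simp: split_beta)
  also have "\<dots> = (\<Sum>(i, j)\<in>I. d i j * (d i j - 1))"
    by (intro sum.cong refl) (auto simp: card_pairs[OF finC] dC I_def)
  also have "\<dots> = (\<Sum>(i, j)\<in>{..<10} \<times> {..<10}. if i = j then 0 else d i j * (d i j - 1))"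
    by (intro sum.mono_neutral_cong_left) (auto simp: I_def)
  also have "\<dots> = w"
    unfolding w_offdiag sum.cartesian_product ..
  finally have cardW: "real (card W) = w" .
  have mem: "((i, j), (k, l)) \<in> W \<longleftrightarrow> i < 10 \<and> j < 10 \<and> k < 10 \<and> l < 10 \<and> i \<noteq> j \<and> k \<noteq> l \<and>
      a i k = 1 \<and> a j k = 1 \<and> a i l = 1 \<and> a j l = 1" for i j k l
    by (auto simp: W_def I_def C_def nbrs_def)
  \<comment> \<open>The swaps of \<open>i\<close> with \<open>j\<close>, of \<open>k\<close> with
    \<open>l\<close>, and of the two diagonals are used in turn. The last preserves both earlier
    orderings, and \<open>i\<close>, \<open>k\<close> differ because they are adjacent.\<close>
  define W1 where "W1 = {z \<in> W. case z of ((i, j), (k, l)) \<Rightarrow> i < j}"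
  define W2 where "W2 = {z \<in> W1. case z of ((i, j), (k, l)) \<Rightarrow> k < l}"
  define W3 where "W3 = {z \<in> W2. case z of ((i, j), (k, l)) \<Rightarrow> i < k}"
  have "card W = 2 * card W1"
    unfolding W1_def using finW
    by (intro card_involution_half[where f = "\<lambda>((i, j), (k, l)). ((j, i), (k, l))"])
      (auto simp: mem)
  moreover have "card W1 = 2 * card W2"
    unfolding W2_def using finW
    by (intro card_involution_half[where f = "\<lambda>((i, j), (k, l)). ((i, j), (l, k))"])
      (auto simp: mem W1_def)
  moreover have "card W2 = 2 * card W3"
    unfolding W3_def using finW
    by (intro card_involution_half[where f = "\<lambda>((i, j), (k, l)). ((k, l), (i, j))"])
      (auto simp: mem W1_def W2_def sym loopless not_less le_less)
  ultimately show ?thesis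
    using cardW by (intro exI[of _ "card W3"]) simp
qed

section \<open>The trace of the cube of the codegree matrix\<close>

lemma x_sym: "i < 10 \<Longrightarrow> j < 10 \<Longrightarrow> x i j = x j i"
  by (auto simp: x_def d_sym)

lemma x_row: "i < 10 \<Longrightarrow> (\<Sum>j<10. x i j) = 7"
  by (simp add: x_def sum_subtractf d_row)

lemma one_minus_x: 
  assumes "i < 10" "j < 10"
  shows "1 - x i j = p i j - q i j"
  using d_cases[OF assms] d_diag[of i] assms by (auto simp: x_def p_def q_def)

lemma x_squares: "(\<Sum>i<10. \<Sum>j<10. x i j * x j i) = 70 + w"
proof -
  have "(\<Sum>i<10. \<Sum>j<10. x i j * x j i) = (\<Sum>i<10. \<Sum>j<10. (d i j)\<^sup>2 - (if i = j then 8 else 0))"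
    by (intro sum.cong refl) (auto simp: x_def d_diag power2_eq_square d_sym)
  then show ?thesis by (simp add: sum_subtractf w_def)
qed

text \<open>This is -tr N^3 for N = J - \<open>x\<close>, with the sign with which it enters the
  sixth moment, so that only upper bounds on it are needed.\<close>

definition S :: real where
  "S = (\<Sum>i<10. \<Sum>j<10. \<Sum>k<10. - ((1 - x i j) * (1 - x j k) * (1 - x k i)))"

text \<open>Besides the cubic term, the expansion contains only sums that the row sums 7 determine:
  370 = 1000 + 3 * 490 - 3 * 700.\<close>

lemma x_cubes: "(\<Sum>i<10::nat. \<Sum>j<10::nat. \<Sum>k<10::nat. x i j * x j k * x k i) = 370 + S"
proof -
  have r: "i < 10 \<Longrightarrow> (\<Sum>j<10. x j i) = 7" for i
    using x_row[of i] x_sym[of i] by simp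
  have e1: "(\<Sum>i<10::nat. \<Sum>j<10::nat. \<Sum>k<10::nat. x i j) = 700"
    "(\<Sum>i<10::nat. \<Sum>j<10::nat. \<Sum>k<10::nat. x j k) = 700" "(\<Sum>i<10::nat. \<Sum>j<10::nat. \<Sum>k<10::nat. x k i) = 700"
    by (simp_all add: sum_distrib_left[symmetric] x_row r)
  have e2: "(\<Sum>i<10::nat. \<Sum>j<10::nat. \<Sum>k<10::nat. x i j * x j k) = 490"
    by (simp add: sum_distrib_left[symmetric] sum_distrib_right[symmetric] x_row)
  have e3: "(\<Sum>i<10::nat. \<Sum>j<10::nat. \<Sum>k<10::nat. x i j * x k i) = 490"
    by (simp add: sum_distrib_left[symmetric] sum_distrib_right[symmetric] x_row r)
  have e4: "(\<Sum>i<10::nat. \<Sum>j<10::nat. \<Sum>k<10::nat. x j k * x k i) = 490"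
    by (subst sum.swap[of _ "{..<10}"], subst (2) sum.swap)
       (simp add: sum_distrib_left[symmetric] sum_distrib_right[symmetric] x_row r)
  have "S = (\<Sum>i<10::nat. \<Sum>j<10::nat. \<Sum>k<10::nat. x i j * x j k * x k i + (x i j + x j k + x k i)
      - (x i j * x j k + x i j * x k i + x j k * x k i) - 1)"
    unfolding S_def by (intro sum.cong refl) (simp add: algebra_simps)
  then show ?thesis
    by (simp only: sum_subtractf sum.distrib e1 e2 e3 e4) simp
qed

text \<open>As \<open>d\<close> is \<open>x\<close> + 2 I, this is the trace of x^3 + 6 x^2 + 12 x +
  8 I, with contributions 370 + \<open>S\<close>, 6 (70 + \<open>w\<close>), 120 and 80.\<close>

lemma d_cubes: "(\<Sum>i<10. \<Sum>j<10. \<Sum>k<10. d i j * d j k * d k i) = 990 + 6 * w + S"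
proof -
  let ?e = "\<lambda>i j :: nat. if i = j then 1 else 0 :: real"
  have sum_if: "(\<Sum>k\<in>A. if P then f k else 0) = (if P then \<Sum>k\<in>A. f k else 0)"
    for f :: "nat \<Rightarrow> real" and A P by simp
  have mult_if: "c * (if P then 1 else 0) = (if P then c else 0)"
    "(if P then b else 0) * c = (if P then b * c else 0)" for b c :: real and P by auto
  have "(\<Sum>i<10. \<Sum>j<10. \<Sum>k<10. d i j * d j k * d k i)
     = (\<Sum>i<10. \<Sum>j<10. \<Sum>k<10. x i j * x j k * x k i)
       + 2 * (\<Sum>i<10. \<Sum>j<10. \<Sum>k<10. x i j * x j k * ?e k i)
       + 2 * (\<Sum>i<10. \<Sum>j<10. \<Sum>k<10. x i j * ?e j k * x k i)
       + 2 * (\<Sum>i<10. \<Sum>j<10. \<Sum>k<10. ?e i j * x j k * x k i)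
       + 4 * (\<Sum>i<10. \<Sum>j<10. \<Sum>k<10. x i j * ?e j k * ?e k i)
       + 4 * (\<Sum>i<10. \<Sum>j<10. \<Sum>k<10. ?e i j * x j k * ?e k i)
       + 4 * (\<Sum>i<10. \<Sum>j<10. \<Sum>k<10. ?e i j * ?e j k * x k i)
       + 8 * (\<Sum>i<10. \<Sum>j<10. \<Sum>k<10. ?e i j * ?e j k * ?e k i)"
    unfolding sum_distrib_left sum.distrib[symmetric]
    by (intro sum.cong refl) (simp add: x_def algebra_simps)
  also have "\<dots> = (370 + S) + 6 * (70 + w) + 12 * (\<Sum>i<10. x i i) + 80"
    by (simp add: x_cubes mult_if sum_if flip: x_squares)
  also have "(\<Sum>i<10. x i i) = 10"
    by (simp add: x_def d_diag)
  finally show ?thesis by simp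
qed

section \<open>Upper bounds for \<open>S\<close> when there are few 4-cycles\<close>

lemma p_bounds: "0 \<le> p i j" "p i j \<le> 1"
  by (auto simp: p_def)

lemma q_nonneg: "0 \<le> q i j"
  by (auto simp: q_def)

lemma p_sym: "i < 10 \<Longrightarrow> j < 10 \<Longrightarrow> p i j = p j i"
  and q_sym: "i < 10 \<Longrightarrow> j < 10 \<Longrightarrow> q i j = q j i"
  by (auto simp: p_def q_def d_sym)

lemma n_nonneg: "0 \<le> n i"
  unfolding n_def by (intro sum_nonneg q_nonneg)

lemma n_col: "i < 10 \<Longrightarrow> (\<Sum>j<10. q j i) = n i"
  unfolding n_def by (intro sum.cong refl) (simp add: q_sym)

lemma p_row:
  assumes "i < 10" shows "(\<Sum>j<10. p i j) = 3 + n i"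
proof -
  have "(\<Sum>j<10. p i j) - n i = (\<Sum>j<10. 1 - x i j)"
    unfolding n_def sum_subtractf[symmetric] using assms by (intro sum.cong refl) (simp add: one_minus_x)
  then show ?thesis by (simp add: sum_subtractf x_row assms)
qed

lemma p_col: "i < 10 \<Longrightarrow> (\<Sum>j<10. p j i) = 3 + n i"
  by (subst p_row[symmetric]) (auto intro!: sum.cong p_sym)

lemma q_squares: "(\<Sum>i<10. \<Sum>j<10. (q i j)\<^sup>2) = w - m"
proof -
  have "(\<Sum>i<10. \<Sum>j<10. (q i j)\<^sup>2) + m = (\<Sum>i<10. \<Sum>j<10. (q i j)\<^sup>2 + q i j)"
    by (simp add: m_def n_def sum.distrib)
  also have "\<dots> = w"
    unfolding w_offdiag
  proof (intro sum.cong refl)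
    fix i j :: nat assume "i \<in> {..<10}" "j \<in> {..<10}"
    then show "(q i j)\<^sup>2 + q i j = (if i = j then 0 else d i j * (d i j - 1))"
      using d_cases[of i j] by (auto simp: q_def)
  qed
  finally show ?thesis by simp
qed

text \<open>The rows and columns \<open>i\<close> and \<open>j\<close> together contribute \<open>2 (n i + n j - q i j)\<close> to \<open>m\<close>.\<close>

lemma n_pair:
  assumes "i < 10" "j < 10" "i \<noteq> j"
  shows "n i + n j \<le> m / 2 + q i j"
proof -
  let ?R = "{..<10} - {i, j}"
  have split: "(\<Sum>k<10. f k) = f i + f j + (\<Sum>k\<in>?R. f k)" for f :: "nat \<Rightarrow> real"
  proof -
    have "{..<10} = insert i (insert j ?R)" using assms by auto
    then show ?thesis using assms(3)
      by (metis (no_types, lifting) Diff_iff add.assoc finite_Diff finite_insert finite_lessThan insert_iff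
          sum.insert)
  qed
  have "q k i + q k j \<le> n k" if "k < 10" for k
    unfolding n_def split using sum_nonneg[of ?R "\<lambda>l. q k l"] q_nonneg by auto
  then have "(\<Sum>k\<in>?R. q k i + q k j) \<le> (\<Sum>k\<in>?R. n k)"
    by (intro sum_mono) auto
  moreover have "(\<Sum>k\<in>?R. q k i) = n i - q i j" "(\<Sum>k\<in>?R. q k j) = n j - q i j"
    using split[of "\<lambda>k. q k i"] split[of "\<lambda>k. q k j"] n_col assms q_sym
    by (auto simp: q_def[of i i] q_def[of j j])
  moreover have "m = n i + n j + (\<Sum>k\<in>?R. n k)"
    unfolding m_def by (rule split)
  ultimately have "n i - q i j + (n j - q i j) \<le> m - (n i + n j)"
    by (simp add: sum.distrib)
  then show ?thesis by linarith
qed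

text \<open>By symmetry of \<open>q\<close>, twice the sum of squares is the sum of
  \<open>q i j * (n i + n j)\<close>. Now \<open>n_pair\<close> bounds the bracket, and the squares
  of \<open>q\<close> sum to \<open>w - m\<close>.\<close>

lemma n_squares: "4 * (\<Sum>i<10. (n i)\<^sup>2) \<le> m\<^sup>2 + 2 * (w - m)"
proof -
  have "2 * (\<Sum>i<10. (n i)\<^sup>2) = (\<Sum>i<10. n i * (\<Sum>j<10. q i j)) + (\<Sum>j<10. n j * (\<Sum>i<10. q i j))"
    by (simp add: n_col n_def[symmetric] power2_eq_square)
  also have "(\<Sum>j<10. n j * (\<Sum>i<10. q i j)) = (\<Sum>i<10. \<Sum>j<10. q i j * n j)"
    unfolding sum_distrib_left by (subst sum.swap) (simp add: mult.commute)
  also have "(\<Sum>i<10. n i * (\<Sum>j<10. q i j)) + \<dots> = (\<Sum>i<10. \<Sum>j<10. q i j * (n i + n j))"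
    unfolding sum_distrib_left distrib_left sum.distrib by (simp only: mult.commute)
  also have "\<dots> \<le> (\<Sum>i<10. \<Sum>j<10. q i j * (m / 2) + (q i j)\<^sup>2)"
  proof (intro sum_mono)
    fix i j :: nat assume "i \<in> {..<10}" "j \<in> {..<10}"
    then show "q i j * (n i + n j) \<le> q i j * (m / 2) + (q i j)\<^sup>2"
      using mult_left_mono[OF n_pair q_nonneg, of i j i j]
      by (cases "i = j") (auto simp: q_def[of i i] q_def[of j j] power2_eq_square distrib_left)
  qed
  also have "\<dots> = m\<^sup>2 / 2 + (w - m)"
    unfolding sum.distrib q_squares sum_distrib_right[symmetric] n_def[symmetric] m_def[symmetric]
    by (simp add: power2_eq_square)
  finally show ?thesis by (simp add: field_simps)
qed

text \<open>In -(p - q)^3 only products with one or three factors \<open>q\<close> count positively.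
  Bounding one factor \<open>p\<close> by 1, or one factor \<open>q\<close> by \<open>c\<close>,
  leaves two factors summed through a common vertex; each of the three mixed sums is
  \<open>3 * m\<close> plus the sum of squares of \<open>n\<close>.\<close>

lemma S_le:
  assumes q: "\<And>i j. i < 10 \<Longrightarrow> j < 10 \<Longrightarrow> q i j \<le> c"
  shows "S \<le> 9 * m + (3 + c) * (\<Sum>i<10. (n i)\<^sup>2)"
proof -
  have c: "0 \<le> c" using q[of 0 0] by (simp add: q_def)
  have pt: "- ((1 - x i j) * (1 - x j k) * (1 - x k i))
      \<le> p i j * q k i + p i j * q j k + q i j * p j k + c * (q i j * q j k)"
    if "i < 10" "j < 10" "k < 10" for i j k
  proof -
    have "p i j * p j k * q k i \<le> p i j * 1 * q k i" "p i j * q j k * p k i \<le> p i j * q j k * 1"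
      "q i j * p j k * p k i \<le> q i j * p j k * 1" "q i j * q j k * q k i \<le> q i j * q j k * c"
      using p_bounds q_nonneg q that by (intro mult_mono mult_nonneg_nonneg order_refl; simp)+
    moreover have "0 \<le> p i j * p j k * p k i" "0 \<le> p i j * q j k * q k i"
      "0 \<le> q i j * p j k * q k i" "0 \<le> q i j * q j k * p k i"
      using p_bounds q_nonneg by auto
    ultimately show ?thesis
      using that by (simp add: one_minus_x algebra_simps)
  qed
  have "S \<le> (\<Sum>i<10. \<Sum>j<10. \<Sum>k<10. p i j * q k i + p i j * q j k + q i j * p j k + c * (q i j * q j k))"
    unfolding S_def using pt by (intro sum_mono) auto
  also have "\<dots> = 9 * m + (3 + c) * (\<Sum>i<10. (n i)\<^sup>2)"
  proof -
    have dist: "(\<Sum>i<10. (3 + n i) * n i) = 3 * m + (\<Sum>i<10. (n i)\<^sup>2)"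
      by (simp add: m_def distrib_right sum.distrib sum_distrib_left power2_eq_square)
    have "(\<Sum>i<10. \<Sum>j<10. \<Sum>k<10. p i j * q k i) = (\<Sum>i<10. (3 + n i) * n i)"
      by (simp add: sum_distrib_left[symmetric] sum_distrib_right[symmetric] n_col p_row)
    moreover have "(\<Sum>i<10. \<Sum>j<10. \<Sum>k<10. p i j * q j k) = (\<Sum>j<10. \<Sum>i<10. p i j * n j)"
      by (subst sum.swap) (simp add: sum_distrib_left[symmetric] n_def[symmetric])
    moreover have "\<dots> = (\<Sum>i<10. (3 + n i) * n i)"
      by (simp add: sum_distrib_right[symmetric] p_col)
    moreover have "(\<Sum>i<10. \<Sum>j<10. \<Sum>k<10. q i j * p j k) = (\<Sum>j<10. \<Sum>i<10. q i j * (3 + n j))"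
      by (subst sum.swap) (simp add: sum_distrib_left[symmetric] p_row)
    moreover have "\<dots> = (\<Sum>i<10. (3 + n i) * n i)"
      by (simp add: sum_distrib_right[symmetric] n_col mult.commute)
    moreover have "(\<Sum>i<10. \<Sum>j<10. \<Sum>k<10. c * (q i j * q j k)) = c * (\<Sum>j<10. \<Sum>i<10. q i j * n j)"
      by (subst (2) sum.swap) (simp add: sum_distrib_left[symmetric] n_def[symmetric])
    moreover have "(\<Sum>j<10. \<Sum>i<10. q i j * n j) = (\<Sum>i<10. (n i)\<^sup>2)"
      by (simp add: sum_distrib_right[symmetric] n_col power2_eq_square)
    ultimately show ?thesis
      unfolding sum.distrib by (simp only: dist) (simp add: algebra_simps)
  qed
  finally show ?thesis .
qed

text \<open>Either distinct vertices share at most two neighbours, and then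
  \<open>2 * m = w\<close>, or some pair shares all three. The second case needs the cruder
  \<open>c = 2\<close> but lowers \<open>m\<close> by at least 2, which more than compensates. The
  values 60 and 152 are \<open>11 * m + m\<^sup>2\<close> at \<open>m = 4\<close> and
  \<open>m = 8\<close>.\<close>

lemma S_le_small:
  shows "w = 0 \<Longrightarrow> S \<le> 0" and "w = 8 \<Longrightarrow> S \<le> 60" and "w = 16 \<Longrightarrow> S \<le> 152"
proof -
  have m0: "0 \<le> m" unfolding m_def by (intro sum_nonneg n_nonneg)
  have qc: "q i j = 0 \<or> q i j = 1 \<or> q i j = 2" if "i < 10" "j < 10" for i j
    using d_cases[OF that] by (auto simp: q_def)
  have ex: "w - 2 * m = (\<Sum>i<10. \<Sum>j<10. (q i j)\<^sup>2 - q i j)"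
    using q_squares by (simp add: sum_subtractf m_def n_def)
  have nn: "0 \<le> (\<Sum>i<10. (n i)\<^sup>2)"
    by (intro sum_nonneg) auto
  consider (small) "\<And>i j. i < 10 \<Longrightarrow> j < 10 \<Longrightarrow> q i j \<le> 1" | (big) i j where "i < 10" "j < 10" "q i j = 2"
    using qc by (metis order_refl zero_le_one)
  then have "S \<le> 11 * m + m\<^sup>2 \<and> 2 * m = w \<or> 4 * S \<le> 26 * m + 5 * m\<^sup>2 + 10 * w \<and> 2 * m \<le> w - 4"
  proof cases
    case small
    have "w - 2 * m = 0"
      unfolding ex using qc small by (intro sum.neutral ballI) force
    then show ?thesis
      using S_le[of 1] small n_squares by (auto simp: field_simps)
  next
    case big
    have ij: "i \<noteq> j" using big by (auto simp: q_def)
    \<comment> \<open>The pair occurs in both orders, each time with \<open>q\<^sup>2 - q\<close>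
      equal to 2; hence the 4.\<close>
    have "(q i j)\<^sup>2 - q i j + ((q j i)\<^sup>2 - q j i) = (\<Sum>(k, l)\<in>{(i, j), (j, i)}. (q k l)\<^sup>2 - q k l)"
      using ij by simp
    also have "\<dots> \<le> (\<Sum>(k, l)\<in>{..<10} \<times> {..<10}. (q k l)\<^sup>2 - q k l)"
      using big by (intro sum_mono2) (auto dest: qc)
    finally have "4 \<le> w - 2 * m"
      unfolding ex sum.cartesian_product using big q_sym[of i j] by simp
    moreover have "S \<le> 9 * m + 5 * (\<Sum>i<10. (n i)\<^sup>2)"
      using S_le[of 2] qc by force
    ultimately show ?thesis
      using n_squares by (simp add: field_simps)
  qed
  moreover have "m\<^sup>2 \<le> 36" if "2 * m \<le> 12"
    using that m0 power_mono[of m 6 2] by simp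
  moreover have "m\<^sup>2 \<le> 4" if "2 * m \<le> 4"
    using that m0 power_mono[of m 2 2] by simp
  ultimately show "w = 0 \<Longrightarrow> S \<le> 0" and "w = 8 \<Longrightarrow> S \<le> 60" and "w = 16 \<Longrightarrow> S \<le> 152"
    using m0 by (auto simp: power2_eq_square)
qed

end

section \<open>The energy bound\<close>

text \<open>Its four coefficients are fixed by value and slope of |u| at 1 and at 2. Each contact is
  a double root of the difference, and the cofactor has positive coefficients.\<close>

lemma abs_le_sextic: "\<bar>u\<bar> \<le> 11 / 27 + 25 / 36 * u\<^sup>2 + (- 1 / 9) * u ^ 4 + 1 / 108 * u ^ 6" for u :: real
proof -
  define v where "v = \<bar>u\<bar>"
  have v: "0 \<le> v" "u\<^sup>2 = v\<^sup>2" "u ^ 4 = v ^ 4" "u ^ 6 = v ^ 6"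
    by (auto simp: v_def power_even_abs)
  have "(v ^ 6 - 12 * v ^ 4 + 75 * v\<^sup>2 + 44) - 108 * v = ((v - 1) * (v - 2))\<^sup>2 * (v\<^sup>2 + 6 * v + 11)"
    by (simp add: algebra_simps power2_eq_square power4_eq_xxxx eval_nat_numeral)
  also have "\<dots> \<ge> 0"
    using v(1) by (intro mult_nonneg_nonneg add_nonneg_nonneg) auto
  finally show ?thesis by (simp add: v v_def[symmetric])
qed

text \<open>The previous bound at \<open>4 u / 5\<close>, so that contact occurs at \<open>5 / 4\<close> and \<open>5 / 2\<close>.\<close>

lemma abs_le_sextic_scaled: 
  "\<bar>u\<bar> \<le> 55 / 108 + 5 / 9 * u\<^sup>2 + (- 64 / 1125) * u ^ 4 + 256 / 84375 * u ^ 6" for u :: real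
proof -
  have "\<bar>4 / 5 * u\<bar> \<le> 11 / 27 + 25 / 36 * (4 / 5 * u)\<^sup>2 + (- 1 / 9) * (4 / 5 * u) ^ 4 + 1 / 108 * (4 / 5 * u) ^ 6"
    by (rule abs_le_sextic)
  then show ?thesis
    by (simp add: abs_mult power_mult_distrib power_divide field_simps)
qed

text \<open>The quartic is tangent to |u| at 4/3 and crosses it at 3, the largest modulus an
  eigenvalue can have. Its negative leading coefficient lets every 4-cycle lower the bound.\<close>

lemma abs_le_quartic:
  "\<bar>u\<bar> \<le> 3 \<Longrightarrow> \<bar>u\<bar> \<le> 102 / 169 + 603 / 1352 * u\<^sup>2 + (- 27 / 1352) * u ^ 4" for u :: real
proof -
  assume le: "\<bar>u\<bar> \<le> 3"
  define v where "v = \<bar>u\<bar>"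
  have v: "0 \<le> v" "v \<le> 3" "u\<^sup>2 = v\<^sup>2" "u ^ 4 = v ^ 4"
    using le by (auto simp: v_def power_even_abs)
  have "(816 + 603 * v\<^sup>2 - 27 * v ^ 4) - 1352 * v = (v - 4 / 3)\<^sup>2 * ((3 - v) * (27 * v + 153))"
    by (simp add: field_simps power2_eq_square power4_eq_xxxx)
  also have "\<dots> \<ge> 0"
    using v(1,2) by (intro mult_nonneg_nonneg) auto
  finally show ?thesis by (simp add: v v_def[symmetric])
qed

lemma sum_list_even_poly:
  "(\<Sum>e\<leftarrow>r. c0 + c2 * e\<^sup>2 + c4 * e ^ 4 + c6 * e ^ 6) =
    c0 * real (length r) + c2 * (\<Sum>e\<leftarrow>r. e\<^sup>2) + c4 * (\<Sum>e\<leftarrow>r. e ^ 4) + c6 * (\<Sum>e\<leftarrow>r. e ^ 6)"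
  for r :: "real list"
  by (induction r) (auto simp: algebra_simps)

lemma sum_list_abs_le_even_poly:
  fixes r :: "real list"
  assumes "\<And>e. e \<in> set r \<Longrightarrow> \<bar>e\<bar> \<le> c0 + c2 * e\<^sup>2 + c4 * e ^ 4 + c6 * e ^ 6"
  shows "(\<Sum>e\<leftarrow>r. \<bar>e\<bar>) \<le>
    c0 * real (length r) + c2 * (\<Sum>e\<leftarrow>r. e\<^sup>2) + c4 * (\<Sum>e\<leftarrow>r. e ^ 4) + c6 * (\<Sum>e\<leftarrow>r. e ^ 6)"
  unfolding sum_list_even_poly[symmetric] using assms by (rule sum_list_mono)

context cubic10
begin

text \<open>With \<open>w = 0\<close> and \<open>S\<close> at most 0 the first sextic gives 13
  without slack; at \<open>w = 8\<close>, \<open>S = 60\<close> it would give 13 + 1/9, whereas the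
  scaled one stays below 13 for \<open>t = 1\<close> and \<open>t = 2\<close>. The quartic gives
  (18144 - 27 \<open>w\<close>) / 1352, which exceeds 13 at \<open>w = 16\<close> but not from
  \<open>w = 24\<close> on.\<close>

lemma sum_abs_le:
  assumes "length r = 9" and bound: "\<And>e. e \<in> set r \<Longrightarrow> \<bar>e\<bar> \<le> 3"
    and m2: "(\<Sum>e\<leftarrow>r. e\<^sup>2) = 21" and m4: "(\<Sum>e\<leftarrow>r. e ^ 4) = 69 + w"
    and m6: "(\<Sum>e\<leftarrow>r. e ^ 6) = 261 + 6 * w + S"
  shows "(\<Sum>e\<leftarrow>r. \<bar>e\<bar>) \<le> 13"
proof -
  obtain t :: nat where t: "w = 8 * real t" using w_dvd by auto
  consider "t = 0" | "t = 1" | "t = 2" | "t \<ge> 3" by linarith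
  then show ?thesis
  proof cases
    case 1
    have "(\<Sum>e\<leftarrow>r. \<bar>e\<bar>) \<le> 11 / 27 * real (length r) + 25 / 36 * (\<Sum>e\<leftarrow>r. e\<^sup>2)
        + (- 1 / 9) * (\<Sum>e\<leftarrow>r. e ^ 4) + 1 / 108 * (\<Sum>e\<leftarrow>r. e ^ 6)"
      using abs_le_sextic by (rule sum_list_abs_le_even_poly)
    then show ?thesis using S_le_small(1) 1 by (simp add: assms t add_divide_distrib)
  next
    case 4
    have "(\<Sum>e\<leftarrow>r. \<bar>e\<bar>) \<le> 102 / 169 * real (length r) + 603 / 1352 * (\<Sum>e\<leftarrow>r. e\<^sup>2)
        + (- 27 / 1352) * (\<Sum>e\<leftarrow>r. e ^ 4) + 0 * (\<Sum>e\<leftarrow>r. e ^ 6)"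
      using abs_le_quartic[OF bound] by (intro sum_list_abs_le_even_poly) simp
    moreover have "real t \<ge> 3" using 4 by simp
    ultimately show ?thesis by (simp add: assms t add_divide_distrib)
  next
    case 2
    have "(\<Sum>e\<leftarrow>r. \<bar>e\<bar>) \<le> 55 / 108 * real (length r) + 5 / 9 * (\<Sum>e\<leftarrow>r. e\<^sup>2)
        + (- 64 / 1125) * (\<Sum>e\<leftarrow>r. e ^ 4) + 256 / 84375 * (\<Sum>e\<leftarrow>r. e ^ 6)"
      using abs_le_sextic_scaled by (rule sum_list_abs_le_even_poly)
    then show ?thesis using S_le_small(2) 2 by (simp add: assms t add_divide_distrib)
  next
    case 3
    have "(\<Sum>e\<leftarrow>r. \<bar>e\<bar>) \<le> 55 / 108 * real (length r) + 5 / 9 * (\<Sum>e\<leftarrow>r. e\<^sup>2)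
        + (- 64 / 1125) * (\<Sum>e\<leftarrow>r. e ^ 4) + 256 / 84375 * (\<Sum>e\<leftarrow>r. e ^ 6)"
      using abs_le_sextic_scaled by (rule sum_list_abs_le_even_poly)
    then show ?thesis using S_le_small(3) 3 by (simp add: assms t add_divide_distrib)
  qed
qed

section \<open>Spectral moments of the adjacency matrix\<close>

definition A :: "real mat" where
  "A = mat 10 10 (\<lambda>(i, j). a i j)"

lemma A_carrier [simp]: "A \<in> carrier_mat 10 10"
  by (simp add: A_def)

definition DD :: "nat \<Rightarrow> nat \<Rightarrow> real" where
  "DD i j = (\<Sum>k<10. d i k * d k j)"

lemma A2_carrier [simp]: "A * A \<in> carrier_mat 10 10"
  by (rule mult_carrier_mat[OF A_carrier A_carrier])

lemma A4_carrier [simp]: "(A * A) * (A * A) \<in> carrier_mat 10 10"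
  by (rule mult_carrier_mat[OF A2_carrier A2_carrier])

lemma A2_index: "i < 10 \<Longrightarrow> j < 10 \<Longrightarrow> (A * A) $$ (i, j) = d i j"
  using index_mat_mult_sum[OF A_carrier A_carrier, of i j] by (simp add: A_def d_def del: index_mult_mat)

lemma A4_index: "i < 10 \<Longrightarrow> j < 10 \<Longrightarrow> ((A * A) * (A * A)) $$ (i, j) = DD i j"
  using index_mat_mult_sum[OF A2_carrier A2_carrier, of i j]
  by (simp add: A2_index DD_def del: index_mult_mat)

lemma pow_A:
  "A ^\<^sub>m 2 = A * A" "A ^\<^sub>m 3 = (A * A) * A" "A ^\<^sub>m 4 = (A * A) * (A * A)"
  "A ^\<^sub>m 6 = (A * A) * ((A * A) * (A * A))" "A ^\<^sub>m 8 = ((A * A) * (A * A)) * ((A * A) * (A * A))"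
proof -
  have step: "A ^\<^sub>m Suc (Suc k) = A ^\<^sub>m k * (A * A)" for k
    using assoc_mult_mat[OF pow_carrier_mat[OF A_carrier] A_carrier A_carrier] by simp
  have pow0: "A ^\<^sub>m 0 * (A * A) = A * A"
    using left_mult_one_mat[OF A2_carrier] by (simp add: A_def)
  show 2: "A ^\<^sub>m 2 = A * A" and "A ^\<^sub>m 3 = (A * A) * A"
    using step[of 0] unfolding pow0 by (simp_all add: eval_nat_numeral)
  show 4: "A ^\<^sub>m 4 = (A * A) * (A * A)"
    using step[of 2] unfolding 2 by (simp add: eval_nat_numeral)
  have 6: "A ^\<^sub>m 6 = ((A * A) * (A * A)) * (A * A)"
    using step[of 4] unfolding 4 by (simp add: eval_nat_numeral)
  then show "A ^\<^sub>m 6 = (A * A) * ((A * A) * (A * A))"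
    using assoc_mult_mat[OF A2_carrier A2_carrier A2_carrier] by simp
  have "A ^\<^sub>m 8 = ((A * A) * (A * A)) * (A * A) * (A * A)"
    using step[of 6] unfolding 6 by (simp add: eval_nat_numeral)
  then show "A ^\<^sub>m 8 = ((A * A) * (A * A)) * ((A * A) * (A * A))"
    using assoc_mult_mat[OF A4_carrier A2_carrier A2_carrier] by simp
qed

lemma trace_A:
  "mat_trace (A ^\<^sub>m 0) = 10" "mat_trace (A ^\<^sub>m 1) = 0" "mat_trace (A ^\<^sub>m 2) = 30"
  "mat_trace (A ^\<^sub>m 3) = (\<Sum>i<10. \<Sum>j<10. d i j * a j i)"
  "mat_trace (A ^\<^sub>m 4) = 150 + w" "mat_trace (A ^\<^sub>m 6) = 990 + 6 * w + S"
  "mat_trace (A ^\<^sub>m 6) = (\<Sum>i<10. \<Sum>j<10. d i j * DD j i)"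
  "mat_trace (A ^\<^sub>m 8) = (\<Sum>i<10. \<Sum>j<10. DD i j * DD j i)"
proof -
  note c = A2_carrier A4_carrier
  show "mat_trace (A ^\<^sub>m 0) = 10" by (simp add: mat_trace_def A_def)
  show "mat_trace (A ^\<^sub>m 1) = 0" by (simp add: mat_trace_def A_def loopless)
  show "mat_trace (A ^\<^sub>m 2) = 30"
    unfolding pow_A mat_trace_def using A2_index d_diag by (simp add: A_def del: index_mult_mat(1))
  show "mat_trace (A ^\<^sub>m 3) = (\<Sum>i<10. \<Sum>j<10. d i j * a j i)"
    unfolding pow_A mat_trace_mult[OF c(1) A_carrier]
    by (intro sum.cong refl) (simp add: A2_index del: index_mult_mat, simp add: A_def)
  show "mat_trace (A ^\<^sub>m 4) = 150 + w"
    unfolding pow_A mat_trace_mult[OF c(1) c(1)] w_def power2_eq_square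
    by (simp add: A2_index d_sym del: index_mult_mat)
  show M6: "mat_trace (A ^\<^sub>m 6) = (\<Sum>i<10. \<Sum>j<10. d i j * DD j i)"
    unfolding pow_A mat_trace_mult[OF c(1) c(2)]
    by (simp add: A2_index A4_index del: index_mult_mat)
  show "mat_trace (A ^\<^sub>m 6) = 990 + 6 * w + S"
    unfolding M6 d_cubes[symmetric] DD_def by (simp add: sum_distrib_left mult.assoc)
  show "mat_trace (A ^\<^sub>m 8) = (\<Sum>i<10. \<Sum>j<10. DD i j * DD j i)"
    unfolding pow_A mat_trace_mult[OF c(2) c(2)]
    by (simp add: A4_index del: index_mult_mat)
qed

text \<open>Exactly one copy of 3 is removed, so the power sums drop by \<open>3 ^ k\<close>.
  Further copies, as in a disconnected graph, stay in \<open>r\<close>.\<close>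

lemma A_spectrum:
  obtains r where "char_poly A = (\<Prod>e\<leftarrow>3 # r. [:- e, 1:])" "length r = 9"
    "\<forall>e\<in>set r. \<bar>e\<bar> \<le> 3" "\<forall>k. (\<Sum>e\<leftarrow>r. e ^ k) = mat_trace (A ^\<^sub>m k) - 3 ^ k"
proof -
  obtain es where es: "char_poly A = (\<Prod>e\<leftarrow>es. [:- e, 1:])" "length es = 10"
    using symmetric_mat_char_poly_splits[OF A_carrier] sym by (auto simp: A_def)
  have rows: "(\<Sum>j<10. A $$ (i, j)) = 3" "(\<Sum>j<10. \<bar>A $$ (i, j)\<bar>) \<le> 3" if "i < 10" for i
  proof -
    show "(\<Sum>j<10. A $$ (i, j)) = 3" using cubic that by (simp add: A_def)
    also have "(\<Sum>j<10. A $$ (i, j)) = (\<Sum>j<10. \<bar>A $$ (i, j)\<bar>)"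
      using that zero_one[OF that] by (intro sum.cong refl) (force simp: A_def)
    finally show "(\<Sum>j<10. \<bar>A $$ (i, j)\<bar>) \<le> 3" by simp
  qed
  have mem: "3 \<in> set es"
    using eigenvalue_row_sum[OF A_carrier rows(1)] eigenvalue_linear_factors[OF A_carrier es(1)] by simp
  define r where "r = remove1 3 es"
  have ms: "mset es = mset (3 # r)" using mem by (simp add: r_def)
  have prod: "char_poly A = (\<Prod>e\<leftarrow>3 # r. [:- e, 1:])"
    unfolding es(1) prod_mset_prod_list[symmetric] mset_map ms ..
  show ?thesis
  proof (rule that[OF prod])
    show "length r = 9" using mset_eq_length[OF ms] es(2) by simp
    show "\<forall>e\<in>set r. \<bar>e\<bar> \<le> 3"
      using eigenvalue_abs_le[OF A_carrier rows(2)] eigenvalue_linear_factors[OF A_carrier prod]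
      by auto
    show "\<forall>k. (\<Sum>e\<leftarrow>r. e ^ k) = mat_trace (A ^\<^sub>m k) - 3 ^ k"
      using mat_trace_pow[OF A_carrier prod] by simp
  qed
qed

definition E :: real where
  "E = (\<Sum>e\<in>#proots (char_poly A). \<bar>e\<bar>)"

lemma E_eq: "char_poly A = (\<Prod>e\<leftarrow>es. [:- e, 1:]) \<Longrightarrow> E = (\<Sum>e\<leftarrow>es. \<bar>e\<bar>)"
  by (simp add: E_def proots_linear_factors sum_mset_sum_list[symmetric])

lemma E_le: "E \<le> 16"
proof -
  obtain r where r: "char_poly A = (\<Prod>e\<leftarrow>3 # r. [:- e, 1:])" "length r = 9"
    "\<forall>e\<in>set r. \<bar>e\<bar> \<le> 3" "\<forall>k. (\<Sum>e\<leftarrow>r. e ^ k) = mat_trace (A ^\<^sub>m k) - 3 ^ k"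
    by (rule A_spectrum)
  note m = r(4)[rule_format]
  have "(\<Sum>e\<leftarrow>r. \<bar>e\<bar>) \<le> 13"
    using r(2) r(3)[rule_format] by (rule sum_abs_le) (simp_all add: m trace_A)
  then show ?thesis unfolding E_eq[OF r(1)] by simp
qed

text \<open>
  \<open>DD = 5 d - 4 I + 4 J\<close> says \<open>(A\<^sup>2 - I) (A\<^sup>2 - 4 I) = 4 J\<close>, so the eigenvalues other than one 3 are
  \<open>\<plusminus>1\<close> and \<open>\<plusminus>2\<close>, the contact points of the sextic.
\<close>

lemma E_eq_16:
  assumes w0: "w = 0" and DD: "\<And>i j. i < 10 \<Longrightarrow> j < 10 \<Longrightarrow> DD i j = 5 * d i j + 4 - (if i = j then 4 else 0)"
  shows "E = 16"
proof -
  obtain r where r: "char_poly A = (\<Prod>e\<leftarrow>3 # r. [:- e, 1:])" "length r = 9"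
    "\<forall>e\<in>set r. \<bar>e\<bar> \<le> 3" "\<forall>k. (\<Sum>e\<leftarrow>r. e ^ k) = mat_trace (A ^\<^sub>m k) - 3 ^ k"
    by (rule A_spectrum)
  note m = r(4)[rule_format]
  have d2: "(\<Sum>i<10. \<Sum>j<10. (d i j)\<^sup>2) = 150" using w0 by (simp add: w_def)
  have M6: "mat_trace (A ^\<^sub>m 6) = 990"
  proof -
    have "mat_trace (A ^\<^sub>m 6) = (\<Sum>i<10. \<Sum>j<10. 5 * (d i j)\<^sup>2 + 4 * d i j - (if i = j then 12 else 0))"
      unfolding trace_A(7)
      by (intro sum.cong refl) (auto simp: DD d_diag d_sym power2_eq_square algebra_simps)
    also have "\<dots> = 990"
      by (simp add: sum_subtractf sum.distrib d_row d2 flip: sum_distrib_left)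
    finally show ?thesis .
  qed
  have M8: "mat_trace (A ^\<^sub>m 8) = 7590"
  proof -
    \<comment> \<open>On the diagonal \<open>DD\<close> is 15 instead of 5 * 3 + 4 = 19, and 136 =
      19^2 - 15^2.\<close>
    have "mat_trace (A ^\<^sub>m 8) = (\<Sum>i<10. \<Sum>j<10. 25 * (d i j)\<^sup>2 + 40 * d i j + 16 - (if i = j then 136 else 0))"
      unfolding trace_A(8)
      by (intro sum.cong refl) (auto simp: DD d_diag d_sym power2_eq_square algebra_simps)
    also have "\<dots> = 7590"
      by (simp add: sum_subtractf sum.distrib d_row d2 flip: sum_distrib_left)
    finally show ?thesis .
  qed
  \<comment> \<open>A vanishing sum of squares locates every element of \<open>r\<close> without
    eigenvectors. The even moments of \<open>r\<close> are 21, 69, 261 and 1029.\<close>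
  have "(\<Sum>e\<leftarrow>r. ((e\<^sup>2 - 1) * (e\<^sup>2 - 4))\<^sup>2)
      = (\<Sum>e\<leftarrow>r. e ^ 8) - 10 * (\<Sum>e\<leftarrow>r. e ^ 6) + 33 * (\<Sum>e\<leftarrow>r. e ^ 4) - 40 * (\<Sum>e\<leftarrow>r. e ^ 2) + 16 * real (length r)"
    by (induction r) (auto simp: algebra_simps power2_eq_square eval_nat_numeral)
  also have "\<dots> = 0"
    using w0 by (simp add: r(2) m M6 M8 trace_A(3,5))
  finally have zero: "\<forall>e\<in>set r. ((e\<^sup>2 - 1) * (e\<^sup>2 - 4))\<^sup>2 = 0"
    by (subst (asm) sum_list_nonneg_eq_0_iff) auto
  have "\<bar>e\<bar> = 11 / 27 + 25 / 36 * e\<^sup>2 + (- 1 / 9) * e ^ 4 + 1 / 108 * e ^ 6" if "e \<in> set r" for e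
  proof -
    have "e\<^sup>2 = 1\<^sup>2 \<or> e\<^sup>2 = 2\<^sup>2" using zero that by auto
    then have "e \<in> {1, - 1, 2, - 2}" unfolding power2_eq_iff by auto
    then show ?thesis by auto
  qed
  then have "(\<Sum>e\<leftarrow>r. \<bar>e\<bar>) = (\<Sum>e\<leftarrow>r. 11 / 27 + 25 / 36 * e\<^sup>2 + (- 1 / 9) * e ^ 4 + 1 / 108 * e ^ 6)"
    by (intro arg_cong[of _ _ sum_list] map_cong refl)
  also have "\<dots> = 13"
    unfolding sum_list_even_poly using w0 by (simp add: r(2) m M6 trace_A(3,5))
  finally show ?thesis unfolding E_eq[OF r(1)] by simp
qed

text \<open>Moments up to order 4 suffice: over \<open>r\<close>, the sum of ((e - 1) (e + 2))^2
  equals \<open>w\<close> + 2 tr A^3. If it vanishes, all nine values are 1 or -2.\<close>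

lemma petersen_spectrum_iff:
  "proots (char_poly A) = replicate_mset 1 3 + replicate_mset 5 1 + replicate_mset 4 (-2) \<longleftrightarrow>
    w = 0 \<and> (\<Sum>i<10. \<Sum>j<10. d i j * a j i) = 0"
proof -
  obtain r where r: "char_poly A = (\<Prod>e\<leftarrow>3 # r. [:- e, 1:])" "length r = 9"
    "\<forall>e\<in>set r. \<bar>e\<bar> \<le> 3" "\<forall>k. (\<Sum>e\<leftarrow>r. e ^ k) = mat_trace (A ^\<^sub>m k) - 3 ^ k"
    by (rule A_spectrum)
  note m = r(4)[rule_format]
  let ?R = "replicate_mset 5 1 + replicate_mset 4 (-2) :: real multiset"
  have roots: "proots (char_poly A) = add_mset 3 (mset r)"
    unfolding r(1) by (subst proots_linear_factors) simp
  have "mset r = ?R \<longleftrightarrow> w = 0 \<and> mat_trace (A ^\<^sub>m 3) = 0"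
  proof
    assume eq: "mset r = ?R"
    have "(\<Sum>e\<leftarrow>r. e ^ k) = (\<Sum>e\<in>#?R. e ^ k)" for k
      unfolding eq[symmetric] by (simp add: sum_mset_sum_list[symmetric])
    from this[of 3] this[of 4] show "w = 0 \<and> mat_trace (A ^\<^sub>m 3) = 0"
      by (simp add: m trace_A(5))
  next
    assume as: "w = 0 \<and> mat_trace (A ^\<^sub>m 3) = 0"
    have "(\<Sum>e\<leftarrow>r. ((e - 1) * (e + 2))\<^sup>2)
      = (\<Sum>e\<leftarrow>r. e ^ 4) + 2 * (\<Sum>e\<leftarrow>r. e ^ 3) - 3 * (\<Sum>e\<leftarrow>r. e ^ 2) - 4 * (\<Sum>e\<leftarrow>r. e ^ 1) + 4 * (\<Sum>e\<leftarrow>r. e ^ 0)"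
      by (induction r) (auto simp: algebra_simps power2_eq_square eval_nat_numeral)
    also have "\<dots> = 0"
      unfolding m trace_A(1,2,3,5) using as by simp
    finally have "\<forall>e\<in>set r. ((e - 1) * (e + 2))\<^sup>2 = 0"
      by (subst (asm) sum_list_nonneg_eq_0_iff) auto
    then have vals: "e = 1 \<or> e = -2" if "e \<in> set r" for e
      using that by auto
    \<comment> \<open>Length 9 and sum -3 are two linear equations for the two
      multiplicities.\<close>
    then have "real (count (mset r) 1) + real (count (mset r) (-2)) = real (length r)
       \<and> real (count (mset r) 1) - 2 * real (count (mset r) (-2)) = (\<Sum>e\<leftarrow>r. e ^ 1)"
      by (induction r) (force simp: algebra_simps)+
    then have "count (mset r) 1 = 5" "count (mset r) (-2) = 4"
      unfolding m trace_A(2) r(2) by auto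
    then show "mset r = ?R"
      using vals by (intro multiset_eqI) (auto simp: count_eq_zero_iff)
  qed
  then show ?thesis unfolding roots trace_A(4) by simp
qed

end

section \<open>Uniqueness of the Petersen graph\<close>

text \<open>Only the 15 listed edges have to be mapped to edges; \<open>digraph_isoI\<close> obtains
  the converse by counting.\<close>

lemma petersen_labelling:
  fixes N :: "'a \<Rightarrow> 'a set"
  assumes V: "finite V" "card V = 10" and N: "\<And>v. v \<in> V \<Longrightarrow> N v \<subseteq> V" "\<And>v. v \<in> V \<Longrightarrow> card (N v) = 3"
    and sym: "\<And>u v. u \<in> V \<Longrightarrow> v \<in> N u \<Longrightarrow> u \<in> N v" and irrefl: "\<And>v. v \<in> V \<Longrightarrow> v \<notin> N v"
    and tri: "\<And>u v x. u \<in> V \<Longrightarrow> v \<in> N u \<Longrightarrow> x \<in> N u \<Longrightarrow> x \<notin> N v"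
    and sq: "\<And>u v x y. u \<in> V \<Longrightarrow> v \<in> V \<Longrightarrow> u \<noteq> v \<Longrightarrow>
      x \<in> N u \<Longrightarrow> x \<in> N v \<Longrightarrow> y \<in> N u \<Longrightarrow> y \<in> N v \<Longrightarrow> x = y"
  obtains f where "bij_betw f {0..<10} V" "\<And>i j. (i, j) \<in> petersen_edges \<Longrightarrow> f j \<in> N (f i)"
proof -
  have finN: "finite (N v)" if "v \<in> V" for v
    using N(1)[OF that] V(1) by (rule finite_subset)
  \<comment> \<open>The ball of radius 2 around \<open>u\<close> has 1 + 3 + 6 = 10 vertices, hence
    is all of \<open>V\<close>; without triangles and 4-cycles nothing is counted twice.\<close>
  have common: "\<exists>x. x \<in> N u \<and> x \<in> N v" if uv: "u \<in> V" "v \<in> V" "u \<noteq> v" "v \<notin> N u" for u v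
  proof -
    let ?U = "\<Union>x\<in>N u. N x - {u}"
    have NV: "x \<in> V" if "x \<in> N u" for x using N(1) uv(1) that by auto
    have "card (N x - {u}) = 2" if "x \<in> N u" for x
      using sym[OF uv(1) that] N(2)[OF NV[OF that]] finN[OF NV[OF that]] by simp
    moreover have "(N x - {u}) \<inter> (N y - {u}) = {}" if "x \<in> N u" "y \<in> N u" "x \<noteq> y" for x y
      using sq[OF NV[OF that(1)] NV[OF that(2)] that(3)] sym[OF uv(1)] that by blast
    ultimately have "card ?U = (\<Sum>x\<in>N u. 2)"
      using finN NV uv(1) by (subst card_UN_disjoint) auto
    then have U: "card ?U = 6" using N(2)[OF uv(1)] by simp
    have finU: "finite ?U" using finN NV uv(1) by auto
    have "?U \<inter> N u = {}" using tri[OF uv(1)] by blast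
    then have "card (?U \<union> N u) = 9"
      using finU finN[OF uv(1)] U N(2)[OF uv(1)] by (simp add: card_Un_disjoint)
    moreover have "u \<notin> ?U \<union> N u" using irrefl[OF uv(1)] by auto
    ultimately have "card (insert u (?U \<union> N u)) = 10"
      using finU finN[OF uv(1)] by simp
    moreover have "insert u (?U \<union> N u) \<subseteq> V" using N(1) NV uv(1) by blast
    ultimately have "insert u (?U \<union> N u) = V"
      using V by (intro card_subset_eq) auto
    then have "v \<in> ?U" using uv by auto
    then obtain x where "x \<in> N u" "v \<in> N x" by auto
    then show ?thesis using sym NV by auto
  qed
  have third: "\<exists>z. N v = {x, y, z} \<and> z \<noteq> x \<and> z \<noteq> y" if "v \<in> V" "x \<in> N v" "y \<in> N v" "x \<noteq> y" for v x y
  proof -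
    have "card (N v - {x, y}) = 1"
      using that N(2)[OF that(1)] finN[OF that(1)] by (simp add: card_Diff_subset)
    then obtain z where "N v - {x, y} = {z}" by (auto simp: card_1_singleton_iff)
    then have "N v = {x, y, z} \<and> z \<noteq> x \<and> z \<noteq> y" using that by blast
    then show ?thesis by blast
  qed
  obtain v0 where v0: "v0 \<in> V" using V by fastforce
  obtain v1 v4 u where Nv0: "N v0 = {v1, v4, u}" "v1 \<noteq> v4"
    using N(2)[OF v0] by (auto simp: card_3_iff)
  have v14: "v1 \<in> V" "v4 \<in> V" using N(1)[OF v0] Nv0 by auto
  have "\<not> N v1 \<subseteq> {v0}"
    using N(2)[OF v14(1)] card_mono[of "{v0}" "N v1"] by auto
  then obtain v2 where v2: "v2 \<in> N v1" "v2 \<noteq> v0" by auto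
  have v2V: "v2 \<in> V" using N(1)[OF v14(1)] v2 by auto
  have e01: "v1 \<in> N v0" "v0 \<in> N v1" and e04: "v4 \<in> N v0" "v0 \<in> N v4" and e12: "v2 \<in> N v1" "v1 \<in> N v2"
    using Nv0 v0 sym v2 v14 by auto
  have n24: "v2 \<noteq> v4" using tri[OF v0 e01(1) e04(1)] v2 by auto
  \<comment> \<open>Otherwise \<open>v0\<close>, \<open>v1\<close>, \<open>v2\<close>,
    \<open>v4\<close> would form a 4-cycle. The common neighbour \<open>v3\<close> of
    \<open>v2\<close> and \<open>v4\<close> then closes the 5-cycle that becomes the outer
    cycle.\<close>
  have "v4 \<notin> N v2" using sq[OF v0 v2V _ e01(1) e12(2) e04(1)] v2(2) Nv0(2) by auto
  then obtain v3 where v3: "v3 \<in> N v2" "v3 \<in> N v4" using common[OF v2V v14(2) n24] by auto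
  have v3V: "v3 \<in> V" using N(1)[OF v2V] v3 by auto
  note V5 = v0 v14(1) v2V v3V v14(2)
  have e23: "v3 \<in> N v2" "v2 \<in> N v3" and e34: "v4 \<in> N v3" "v3 \<in> N v4"
    using v3 sym V5 by auto
  have d5: "distinct [v0, v1, v2, v3, v4]"
    using irrefl V5 e01 e12 e23 e34 e04 v2(2) n24 Nv0(2) tri[OF v0] tri[OF v14(1)] by auto
  obtain w0 where w0: "N v0 = {v4, v1, w0}" "w0 \<noteq> v4" "w0 \<noteq> v1" using third[OF v0 e04(1) e01(1)] d5 by auto
  obtain w1 where w1: "N v1 = {v0, v2, w1}" "w1 \<noteq> v0" "w1 \<noteq> v2" using third[OF v14(1) e01(2) e12(1)] d5 by auto
  obtain w2 where w2: "N v2 = {v1, v3, w2}" "w2 \<noteq> v1" "w2 \<noteq> v3" using third[OF v2V e12(2) e23(1)] d5 by auto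
  obtain w3 where w3: "N v3 = {v2, v4, w3}" "w3 \<noteq> v2" "w3 \<noteq> v4" using third[OF v3V e23(2) e34(1)] d5 by auto
  obtain w4 where w4: "N v4 = {v3, v0, w4}" "w4 \<noteq> v3" "w4 \<noteq> v0" using third[OF v14(2) e34(2) e04(2)] d5 by auto
  note w = w0 w1 w2 w3 w4
  have wV: "w0 \<in> V" "w1 \<in> V" "w2 \<in> V" "w3 \<in> V" "w4 \<in> V"
    using N(1)[OF v0] N(1)[OF v14(1)] N(1)[OF v2V] N(1)[OF v3V] N(1)[OF v14(2)] w by auto
  \<comment> \<open>Without triangles, the third neighbour of \<open>v\<close> is not a neighbour of
    \<open>x\<close> or \<open>y\<close>; on the 5-cycle this excludes the two vertices opposite to
    \<open>v\<close>.\<close>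
  have off: "z \<noteq> v" "z \<noteq> p" "z \<noteq> p'"
    if "v \<in> V" "N v = {x, y, z}" "p \<in> N x" "p' \<in> N y" for v x y z p p'
    using irrefl[OF that(1)] tri[OF that(1), of x z] tri[OF that(1), of y z] that(2-) by auto
  have vw: "{w0, w1, w2, w3, w4} \<inter> {v0, v1, v2, v3, v4} = {}"
    using off[OF v0 w0(1) e34(2) e12(1)] off[OF v14(1) w1(1) e04(1) e23(1)]
      off[OF v2V w2(1) e01(2) e34(1)] off[OF v3V w3(1) e12(2) e04(2)] off[OF v14(2) w4(1) e23(2) e01(1)]
      w(2-) w1(2-) w2(2-) w3(2-) w4(2-) by simp
  \<comment> \<open>Equal spoke ends would give a triangle over adjacent cycle vertices, and a
    4-cycle over those at distance 2.\<close>
  have "w0 \<noteq> w1" "w1 \<noteq> w2" "w2 \<noteq> w3" "w3 \<noteq> w4" "w4 \<noteq> w0"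
    using tri[OF v0 e01(1), of w0] tri[OF v14(1) e12(1), of w1] tri[OF v2V e23(1), of w2]
      tri[OF v3V e34(1), of w3] tri[OF v14(2) e04(2), of w4] w by auto
  moreover have "w0 \<noteq> w2" "w1 \<noteq> w3" "w2 \<noteq> w4" "w3 \<noteq> w0" "w4 \<noteq> w1"
    using sq[OF v0 v2V, of v1 w0] sq[OF v14(1) v3V, of v2 w1] sq[OF v2V v14(2), of v3 w2]
      sq[OF v3V v0, of v4 w3] sq[OF v14(2) v14(1), of v0 w4] w d5 by auto
  ultimately have dw: "distinct [w0, w1, w2, w3, w4]" by auto
  define xs where "xs = [v0, v1, v2, v3, v4, w0, w1, w2, w3, w4]"
  have dxs: "distinct xs" using d5 dw vw by (auto simp: xs_def)
  have out: "w0 \<notin> N v1" "w0 \<notin> N v2" "w0 \<notin> N v3" "w1 \<notin> N v2" "w1 \<notin> N v3" "w1 \<notin> N v4"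
    "w2 \<notin> N v3" "w2 \<notin> N v4" "w2 \<notin> N v0" "w3 \<notin> N v4" "w3 \<notin> N v0" "w3 \<notin> N v1"
    "w4 \<notin> N v0" "w4 \<notin> N v1" "w4 \<notin> N v2"
    using dxs unfolding xs_def w by auto
  \<comment> \<open>\<open>v\<close> and \<open>z\<close> have a common neighbour, and
    \<open>x\<close>, \<open>y\<close> are ruled out. Applied to \<open>v2\<close>,
    \<open>w0\<close> and the rotations of this pair, this yields the inner pentagram.\<close>
  have link: "z' \<in> N z"
    if as: "v \<in> V" "z \<in> V" "v \<noteq> z" "N v = {x, y, z'}" "z \<notin> N v" "z \<notin> N x" "z \<notin> N y" for v z x y z'
  proof -
    obtain u where "u \<in> N v" "u \<in> N z" using common[OF as(1,2) _ as(5)] as(3) by auto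
    then show ?thesis using sym[OF as(2)] as(4,6,7) by auto
  qed
  have inner: "w2 \<in> N w0" "w3 \<in> N w1" "w4 \<in> N w2" "w0 \<in> N w3" "w1 \<in> N w4"
    using vw link[OF v2V wV(1) _ w2(1) out(2,1,3)] link[OF v3V wV(2) _ w3(1) out(5,4,6)]
      link[OF v14(2) wV(3) _ w4(1) out(8,7,9)] link[OF v0 wV(4) _ w0(1) out(11,10,12)]
      link[OF v14(1) wV(5) _ w1(1) out(14,13,15)] by simp_all
  have bij: "bij_betw ((!) xs) {0..<10} V"
  proof (rule bij_betw_nth[OF dxs])
    show "{0..<10} = {..<length xs}" by (auto simp: xs_def)
    have "set xs \<subseteq> V" using V5 wV by (auto simp: xs_def)
    moreover have "card (set xs) = 10" using distinct_card[OF dxs] by (simp add: xs_def)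
    ultimately show "V = set xs" using V by (metis card_subset_eq)
  qed
  have sp: "w0 \<in> N v0" "w1 \<in> N v1" "w2 \<in> N v2" "w3 \<in> N v3" "w4 \<in> N v4" using w by auto
  have "xs ! j \<in> N (xs ! i)" if "(i, j) \<in> petersen_edges" for i j
  proof -
    have five: "{0..<5} = {0, 1, 2, 3, 4 :: nat}" by auto
    show ?thesis
      using that e01 e12 e23 e34 e04 sp inner unfolding petersen_edges_def five
      by (auto simp: xs_def)
  qed
  with bij show thesis by (rule that)
qed

section \<open>From matrices to graphs\<close>

definition adj :: "'v :: linorder pair_pre_digraph \<Rightarrow> nat \<Rightarrow> nat \<Rightarrow> real" where
  "adj G i j = (if (vertex_list G ! i, vertex_list G ! j) \<in> parcs G then 1 else 0)"

lemma out_degree_with_proj: "out_degree (with_proj G) v = card {u. (v, u) \<in> parcs G}"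
proof -
  have "{e \<in> parcs G. fst e = v} = Pair v ` {u. (v, u) \<in> parcs G}"
    by (auto simp: image_iff)
  then show ?thesis
    by (simp add: out_degree_def out_arcs_def card_image inj_on_def)
qed

lemma regular_graphsD:
  assumes "G \<in> regular_graphs k n"
  shows "finite (pverts G)" "card (pverts G) = n" "finite (parcs G)"
    "\<And>v. v \<in> pverts G \<Longrightarrow> card {u. (v, u) \<in> parcs G} = k"
    "\<And>u v. (u, v) \<in> parcs G \<Longrightarrow> u \<in> pverts G" "\<And>u v. (u, v) \<in> parcs G \<Longrightarrow> v \<in> pverts G"
    "\<And>u v. (u, v) \<in> parcs G \<Longrightarrow> (v, u) \<in> parcs G" "\<And>v. (v, v) \<notin> parcs G"
proof -
  interpret pair_graph G using assms by (simp add: regular_graphs_def)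
  show "finite (pverts G)" "finite (parcs G)" by simp_all
  show "card (pverts G) = n" using assms by (simp add: regular_graphs_def)
  show "card {u. (v, u) \<in> parcs G} = k" if "v \<in> pverts G" for v
    using assms that by (simp add: regular_graphs_def out_degree_with_proj)
  show "u \<in> pverts G" "v \<in> pverts G" if "(u, v) \<in> parcs G" for u v
    using that by (auto dest: in_arcsD1 in_arcsD2)
  show "(v, u) \<in> parcs G" if "(u, v) \<in> parcs G" for u v
    using that arcs_symmetric by blast
  show "(v, v) \<notin> parcs G" for v
    using pair_no_loops[of "(v, v)"] by auto
qed

lemma card_parcs_regular:
  assumes "G \<in> regular_graphs k n" shows "card (parcs G) = n * k"
proof -
  note D = regular_graphsD[OF assms]
  have "parcs G = (SIGMA v:pverts G. {u. (v, u) \<in> parcs G})"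
    using D(5) by auto
  moreover have "finite {u. (v, u) \<in> parcs G}" for v
    by (rule finite_subset[OF _ D(1)]) (use D(6) in auto)
  ultimately have "card (parcs G) = (\<Sum>v\<in>pverts G. card {u. (v, u) \<in> parcs G})"
    using D(1) card_SigmaI by metis
  then show ?thesis using D(2,4) by simp
qed

lemma vertex_list_bij:
  assumes "finite (pverts G)"
  shows "bij_betw ((!) (vertex_list G)) {..<card (pverts G)} (pverts G)"
  unfolding vertex_list_def using assms by (intro bij_betw_nth) auto

lemma cubic10_adj:
  assumes "G \<in> cubic_graphs_10" shows "cubic10 (adj G)"
proof
  note D = regular_graphsD[OF assms[unfolded cubic_graphs_10_def]]
  have bij: "bij_betw ((!) (vertex_list G)) {..<10} (pverts G)"
    using vertex_list_bij[OF D(1)] by (simp add: D(2))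
  show "adj G i j = 0 \<or> adj G i j = 1" "adj G i j = adj G j i" "adj G i i = 0" for i j
    using D(7,8) by (auto simp: adj_def)
  show "(\<Sum>j<10. adj G i j) = 3" if "i < 10" for i
  proof -
    let ?v = "vertex_list G ! i"
    have v: "?v \<in> pverts G" using bij_betwE[OF bij] that by auto
    have "(\<Sum>j<10. adj G i j) = (\<Sum>u\<in>pverts G. if (?v, u) \<in> parcs G then 1 else 0)"
      unfolding adj_def by (rule sum.reindex_bij_betw[OF bij])
    also have "\<dots> = real (card {u. (?v, u) \<in> parcs G})"
      using D(1,6) by (subst sum.inter_filter[symmetric]) (auto intro: arg_cong[of _ _ card])
    finally show ?thesis using D(4)[OF v] by simp
  qed
qed

lemma adjacency_matrix_eq:
  "G \<in> cubic_graphs_10 \<Longrightarrow> adjacency_matrix G = cubic10.A (adj G)"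
  by (simp add: adjacency_matrix_def cubic10.A_def[OF cubic10_adj] adj_def cubic_graphs_10_def
      regular_graphs_def)

lemma randic_matrix_cubic:
  assumes "G \<in> cubic_graphs_10" shows "randic_matrix G = (1 / 3) \<cdot>\<^sub>m adjacency_matrix G"
proof (rule eq_matI)
  note D = regular_graphsD[OF assms[unfolded cubic_graphs_10_def]]
  have v: "vertex_list G ! i \<in> pverts G" if "i < card (pverts G)" for i
    using bij_betwE[OF vertex_list_bij[OF D(1)]] that by auto
  fix i j assume "i < dim_row ((1 / 3) \<cdot>\<^sub>m adjacency_matrix G)" "j < dim_col ((1 / 3) \<cdot>\<^sub>m adjacency_matrix G)"
  then show "randic_matrix G $$ (i, j) = ((1 / 3) \<cdot>\<^sub>m adjacency_matrix G) $$ (i, j)"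
    using D(4)[OF v] by (simp add: randic_matrix_def adjacency_matrix_def out_degree_with_proj)
qed (auto simp: randic_matrix_def adjacency_matrix_def)

lemma energy_eq: "G \<in> cubic_graphs_10 \<Longrightarrow> energy G = cubic10.E (adj G)"
  by (simp add: energy_def adjacency_spectrum_def eigenvalue_mset_def adjacency_matrix_eq
      cubic10.E_def[OF cubic10_adj])

text \<open>The two eigenvalue lists agree up to the factor 1/3, so each Randic claim follows from
  the one on energy.\<close>

lemma randic_energy_cubic:
  assumes G: "G \<in> cubic_graphs_10" shows "randic_energy G = energy G / 3"
proof -
  interpret cubic10 "adj G" using G by (rule cubic10_adj)
  obtain r where r: "char_poly A = (\<Prod>e\<leftarrow>3 # r. [:- e, 1:])"
    by (rule A_spectrum)
  let ?es = "3 # r"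
  have "char_poly (randic_matrix G) = (\<Prod>e\<leftarrow>map (\<lambda>e. 1 / 3 * e) ?es. [:- e, 1:])"
    unfolding randic_matrix_cubic[OF G] adjacency_matrix_eq[OF G] char_poly_smult_splits[OF A_carrier r]
    by (simp add: o_def)
  then have "proots (char_poly (randic_matrix G)) = mset (map (\<lambda>e. 1 / 3 * e) ?es)"
    by (simp only: proots_linear_factors)
  then have "randic_energy G = (\<Sum>e\<leftarrow>?es. \<bar>1 / 3 * e\<bar>)"
    by (simp add: randic_energy_def eigenvalue_mset_def sum_mset_sum_list[symmetric]
        image_mset.compositionality o_def)
  also have "\<dots> = 1 / 3 * (\<Sum>e\<leftarrow>?es. \<bar>e\<bar>)"
    by (subst sum_list_const_mult[symmetric]) (simp add: abs_mult)
  also have "\<dots> = energy G / 3"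
    unfolding energy_eq[OF G] E_eq[OF r] by simp
  finally show ?thesis .
qed

section \<open>Two explicit graphs, given by neighbour lists\<close>

definition list_graph :: "nat list list \<Rightarrow> nat pair_pre_digraph" where
  "list_graph ns = \<lparr>pverts = {0..<10}, parcs = {(i, j). i < 10 \<and> j \<in> set (ns ! i)}\<rparr>"

definition cubic_list :: "nat list list \<Rightarrow> bool" where
  "cubic_list ns \<longleftrightarrow> (\<forall>i<10. length (ns ! i) = 3 \<and> distinct (ns ! i) \<and>
     (\<forall>j\<in>set (ns ! i). j < 10 \<and> j \<noteq> i \<and> i \<in> set (ns ! j)))"

text \<open>An executable counterpart of \<open>d\<close>, so that the conditions on the two graphs
  are decided by evaluation.\<close>

definition codegree :: "nat list list \<Rightarrow> nat \<Rightarrow> nat \<Rightarrow> nat" where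
  "codegree ns i j = length (filter (\<lambda>k. k \<in> set (ns ! j)) (ns ! i))"

definition squarefree_list :: "nat list list \<Rightarrow> bool" where
  "squarefree_list ns \<longleftrightarrow> (\<forall>i<10. \<forall>j<10. i \<noteq> j \<longrightarrow> codegree ns i j \<le> 1)"

definition trianglefree_list :: "nat list list \<Rightarrow> bool" where
  "trianglefree_list ns \<longleftrightarrow> (\<forall>i<10. \<forall>j\<in>set (ns ! i). codegree ns i j = 0)"

text \<open>The hypothesis on \<open>DD\<close> in \<open>E_eq_16\<close>, over the natural numbers;
  the diagonal 4 stands on the left to avoid subtraction.\<close>

definition walk_identity :: "nat list list \<Rightarrow> bool" where
  "walk_identity ns \<longleftrightarrow> (\<forall>i<10. \<forall>j<10.
     sum_list (map (\<lambda>k. codegree ns i k * codegree ns k j) [0..<10]) + (if i = j then 4 else 0)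
       = 5 * codegree ns i j + 4)"

lemma list_graph_cubic:
  assumes "cubic_list ns" shows "list_graph ns \<in> cubic_graphs_10"
proof -
  have c: "length (ns ! i) = 3" "distinct (ns ! i)" "j \<in> set (ns ! i) \<Longrightarrow> j < 10"
    "j \<in> set (ns ! i) \<Longrightarrow> j \<noteq> i" "j \<in> set (ns ! i) \<Longrightarrow> i \<in> set (ns ! j)" if "i < 10" for i j
    using assms that unfolding cubic_list_def by blast+
  have "finite {(i, j). i < (10::nat) \<and> j \<in> set (ns ! i)}"
    by (rule finite_subset[of _ "{..<10} \<times> {..<10}"]) (auto dest: c(3))
  moreover have "symmetric (list_graph ns)"
    unfolding symmetric_def
  proof (rule symI)
    fix u v assume "(u, v) \<in> arcs_ends (with_proj (list_graph ns))"
    then have "u < 10" "v \<in> set (ns ! u)" by (auto simp: list_graph_def)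
    then show "(v, u) \<in> arcs_ends (with_proj (list_graph ns))"
      using c(3,5)[of u v] by (simp add: list_graph_def)
  qed
  ultimately have "pair_graph (list_graph ns)"
    by unfold_locales (auto simp: list_graph_def dest: c(3) c(4))
  moreover have "out_degree (with_proj (list_graph ns)) v = 3" if "v < 10" for v
    using distinct_card[OF c(2)[OF that]] c(1)[OF that] that by (simp add: out_degree_with_proj list_graph_def)
  ultimately show ?thesis
    by (auto simp: cubic_graphs_10_def regular_graphs_def list_graph_def)
qed

lemma adj_list_graph:
  "i < 10 \<Longrightarrow> j < 10 \<Longrightarrow> adj (list_graph ns) i j = (if j \<in> set (ns ! i) then 1 else 0)"
  by (simp add: adj_def vertex_list_def list_graph_def)

lemma d_list_graph:
  assumes ns: "cubic_list ns" and "i < 10" "j < 10"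
  shows "cubic10.d (adj (list_graph ns)) i j = real (codegree ns i j)"
proof -
  interpret cubic10 "adj (list_graph ns)"
    using list_graph_cubic[OF ns] by (rule cubic10_adj)
  have nb: "nbrs i = set (ns ! i)" if i: "i < 10" for i
  proof -
    have "j < 10" if "j \<in> set (ns ! i)" for j
      using ns i that unfolding cubic_list_def by blast
    then show ?thesis using i by (auto simp: nbrs_def adj_list_graph split: if_splits)
  qed
  have "distinct (ns ! i)" using ns assms(2) unfolding cubic_list_def by blast
  then show ?thesis
    unfolding d_eq_card[OF assms(2,3)] nb[OF assms(2)] nb[OF assms(3)] codegree_def
    by (subst distinct_card[symmetric]) (auto intro: arg_cong[of _ _ card])
qed

lemma list_graph_w:
  assumes ns: "cubic_list ns" "squarefree_list ns"
  shows "cubic10.w (adj (list_graph ns)) = 0"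
proof -
  interpret cubic10 "adj (list_graph ns)"
    using list_graph_cubic[OF ns(1)] by (rule cubic10_adj)
  show ?thesis
    unfolding w_eq_0_iff using ns(2) by (simp add: d_list_graph[OF ns(1)] squarefree_list_def)
qed

lemma energy_list_graph:
  assumes ns: "cubic_list ns" "squarefree_list ns" "walk_identity ns"
  shows "energy (list_graph ns) = 16"
proof -
  interpret cubic10 "adj (list_graph ns)"
    using list_graph_cubic[OF ns(1)] by (rule cubic10_adj)
  have "E = 16"
  proof (rule E_eq_16)
    show "w = 0" by (rule list_graph_w[OF ns(1,2)])
    fix i j :: nat assume ij: "i < 10" "j < 10"
    have "DD i j = real (\<Sum>k<10. codegree ns i k * codegree ns k j)"
      using ij by (simp add: DD_def d_list_graph[OF ns(1)])
    also have "(\<Sum>k<10. codegree ns i k * codegree ns k j)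
        = sum_list (map (\<lambda>k. codegree ns i k * codegree ns k j) [0..<10])"
      by (simp add: interv_sum_list_conv_sum_set_nat atLeast0LessThan)
    finally have "DD i j + real (if i = j then 4 else 0) = real (5 * codegree ns i j + 4)"
      using ns(3) ij unfolding walk_identity_def by (metis of_nat_add)
    then show "DD i j = 5 * d i j + 4 - (if i = j then 4 else 0)"
      using ij by (simp add: d_list_graph[OF ns(1)] split: if_splits)
  qed
  then show ?thesis using energy_eq[OF list_graph_cubic[OF ns(1)]] by simp
qed

definition petersen_nbrs :: "nat list list" where
  "petersen_nbrs = [[1, 4, 5], [0, 2, 6], [1, 3, 7], [2, 4, 8], [0, 3, 9],
     [0, 7, 8], [1, 8, 9], [2, 5, 9], [3, 5, 6], [4, 6, 7]]"

text \<open>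
  The second graph of energy 16: two triangles \<open>0, 1, 2\<close> and \<open>3, 4, 5\<close>, joined through the
  leaves \<open>6, 7, 8\<close> of a claw centred at 9.
\<close>

definition mate_nbrs :: "nat list list" where
  "mate_nbrs = [[1, 2, 6], [0, 2, 7], [0, 1, 8], [4, 5, 6], [3, 5, 7], [3, 4, 8],
     [0, 3, 9], [1, 4, 9], [2, 5, 9], [6, 7, 8]]"

lemma petersen_list: "petersen = list_graph petersen_nbrs"
proof -
  \<comment> \<open>The concatenated list makes both sides finite sets that can be evaluated, unlike
    the comprehension in \<open>list_graph\<close>.\<close>
  have "petersen_edges \<union> petersen_edges\<inverse> =
      set (concat (map (\<lambda>i. map (Pair i) (petersen_nbrs ! i)) [0..<10]))"
    by code_simp
  also have "\<dots> = {(i, j). i < 10 \<and> j \<in> set (petersen_nbrs ! i)}"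
    by (auto simp del: upt_Suc upt_rec_numeral)
  finally show ?thesis by (simp add: petersen_def list_graph_def)
qed

text \<open>The Petersen graph gets its energy from its spectrum, the second graph from
  \<open>walk_identity\<close>. The second graph has triangles, which tells the two apart.\<close>

lemma petersen_mate_checks:
  "cubic_list petersen_nbrs" "squarefree_list petersen_nbrs" "trianglefree_list petersen_nbrs"
  "cubic_list mate_nbrs" "squarefree_list mate_nbrs" "walk_identity mate_nbrs"
  by code_simp+

text \<open>Both graphs have \<open>n * k\<close> arcs, so an injective map between the arc sets is
  onto; preserving adjacency in one direction suffices.\<close>

lemma digraph_isoI:
  assumes G: "G \<in> regular_graphs k n" and H: "H \<in> regular_graphs k n"
    and f: "bij_betw f (pverts G) (pverts H)" "\<And>u v. (u, v) \<in> parcs G \<Longrightarrow> (f u, f v) \<in> parcs H"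
  shows "digraph_iso (with_proj G) (with_proj H)"
proof -
  note D = regular_graphsD[OF G]
  interpret pair_graph G using G by (simp add: regular_graphs_def)
  let ?g = "map_prod f f"
  have inj: "inj_on ?g (parcs G)"
    using map_prod_inj_on[OF bij_betw_imp_inj_on[OF f(1)] bij_betw_imp_inj_on[OF f(1)]]
    by (rule inj_on_subset) (use D(5,6) in auto)
  have "?g ` parcs G = parcs H"
  proof (rule card_subset_eq)
    show "finite (parcs H)" using regular_graphsD(3)[OF H] .
    show "?g ` parcs G \<subseteq> parcs H" using f(2) by auto
    show "card (?g ` parcs G) = card (parcs H)"
      using card_image[OF inj] card_parcs_regular[OF G] card_parcs_regular[OF H] by simp
  qed
  moreover have "f ` pverts G = pverts H" using f(1) by (simp add: bij_betw_def)
  ultimately have "with_proj H =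
      app_iso \<lparr>iso_verts = f, iso_arcs = ?g, iso_head = snd, iso_tail = fst\<rparr> (with_proj G)"
    by (simp add: app_iso_def with_proj_def)
  moreover have "digraph_isomorphism \<lparr>iso_verts = f, iso_arcs = ?g, iso_head = snd, iso_tail = fst\<rparr>"
    using inj bij_betw_imp_inj_on[OF f(1)] wf_digraph_axioms by (simp add: digraph_isomorphism_def)
  ultimately show ?thesis unfolding digraph_iso_def by blast
qed

text \<open>A digraph isomorphism carries its own arc map and its own head and tail functions. Here
  the latter must be \<open>snd\<close> and \<open>fst\<close>, which forces the arc map to be
  induced by the vertex map.\<close>

lemma digraph_iso_reflects_triangle:
  assumes iso: "digraph_iso (with_proj G) (with_proj H)"
    and arcs: "\<And>u v. (u, v) \<in> parcs G \<Longrightarrow> u \<in> pverts G \<and> v \<in> pverts G"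
    and H: "(x, y) \<in> parcs H" "(y, z) \<in> parcs H" "(x, z) \<in> parcs H"
  obtains u v w where "(u, v) \<in> parcs G" "(v, w) \<in> parcs G" "(u, w) \<in> parcs G"
proof -
  obtain h where h: "pre_digraph.digraph_isomorphism (with_proj G) h" "with_proj H = app_iso h (with_proj G)"
    using iso unfolding digraph_iso_def by blast
  have inj: "inj_on (iso_verts h) (pverts G)"
    using h(1) by (simp add: pre_digraph.digraph_isomorphism_def)
  have eq: "parcs H = iso_arcs h ` parcs G" "iso_tail h = fst" "iso_head h = snd"
    using h(2) by (auto simp: with_proj_def app_iso_def)
  have "iso_arcs h e = (iso_verts h (fst e), iso_verts h (snd e))" if "e \<in> parcs G" for e
    using h(1) that eq by (auto simp: pre_digraph.digraph_isomorphism_def prod_eq_iff)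
  then have lift: "\<exists>u v. (u, v) \<in> parcs G \<and> a = iso_verts h u \<and> b = iso_verts h v"
    if "(a, b) \<in> parcs H" for a b
    using that unfolding eq(1) by fastforce
  obtain u v where 1: "(u, v) \<in> parcs G" "x = iso_verts h u" "y = iso_verts h v"
    using lift[OF H(1)] by blast
  obtain v' w where 2: "(v', w) \<in> parcs G" "y = iso_verts h v'" "z = iso_verts h w"
    using lift[OF H(2)] by blast
  obtain u' w' where 3: "(u', w') \<in> parcs G" "x = iso_verts h u'" "z = iso_verts h w'"
    using lift[OF H(3)] by blast
  have "v' = v" "u' = u" "w' = w"
    using inj_onD[OF inj] 1 2 3 arcs by metis+
  then show thesis using that 1 2 3 by blast
qed

text \<open>The two vanishing moments are translated from matrix indices to vertices, as the girth
  hypotheses of \<open>petersen_labelling\<close>.\<close>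

lemma petersen_spectrum_imp_iso:
  assumes P: "petersen \<in> cubic_graphs_10" and G: "G \<in> cubic_graphs_10"
    and w: "cubic10.w (adj G) = 0" and t: "(\<Sum>i<10. \<Sum>j<10. cubic10.d (adj G) i j * adj G j i) = 0"
  shows "digraph_iso (with_proj petersen) (with_proj G)"
proof -
  interpret cubic10 "adj G" using G by (rule cubic10_adj)
  note D = regular_graphsD[OF G[unfolded cubic_graphs_10_def]]
  let ?l = "vertex_list G"
  have bij: "bij_betw ((!) ?l) {..<10} (pverts G)"
    using vertex_list_bij[OF D(1)] by (simp add: D(2))
  have index: "\<exists>i<10. v = ?l ! i" if "v \<in> pverts G" for v
    using bij_betw_imp_surj_on[OF bij] that by blast
  have nb: "k \<in> nbrs i \<longleftrightarrow> (?l ! i, ?l ! k) \<in> parcs G" if "k < 10" for i k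
    using that by (simp add: nbrs_def adj_def)
  let ?N = "\<lambda>v. {u. (v, u) \<in> parcs G}"
  have tri: "x \<notin> ?N v" if as: "u \<in> pverts G" "v \<in> ?N u" "x \<in> ?N u" for u v x
  proof
    assume "x \<in> ?N v"
    obtain i j k where ijk: "i < 10" "j < 10" "k < 10" "u = ?l ! i" "v = ?l ! j" "x = ?l ! k"
      using index[of u] index[of v] index[of x] as D(6) by auto
    then have "adj G i j = 1" "k \<in> nbrs i \<inter> nbrs j"
      using as \<open>x \<in> ?N v\<close> by (auto simp: nb adj_def)
    then show False
      using t ijk unfolding trace3_eq_0_iff by (auto simp: d_eq_card)
  qed
  have sq: "x = y" if as: "u \<in> pverts G" "v \<in> pverts G" "u \<noteq> v"
    "x \<in> ?N u" "x \<in> ?N v" "y \<in> ?N u" "y \<in> ?N v" for u v x y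
  proof -
    obtain i j k l where ijkl: "i < 10" "j < 10" "k < 10" "l < 10"
      "u = ?l ! i" "v = ?l ! j" "x = ?l ! k" "y = ?l ! l"
      using index[of u] index[of v] index[of x] index[of y] as D(6) by auto
    have "k \<in> nbrs i \<inter> nbrs j" "l \<in> nbrs i \<inter> nbrs j"
      using as ijkl by (auto simp: nb)
    moreover have "card (nbrs i \<inter> nbrs j) \<le> 1"
      using w as(3) ijkl unfolding w_eq_0_iff by (auto simp: d_eq_card)
    ultimately have "k = l"
      by (auto simp: card_le_Suc0_iff_eq)
    then show ?thesis using ijkl by simp
  qed
  obtain f where f: "bij_betw f {0..<10} (pverts G)" "\<And>i j. (i, j) \<in> petersen_edges \<Longrightarrow> f j \<in> ?N (f i)"
  proof (rule petersen_labelling[of "pverts G" ?N])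
    show "finite (pverts G)" "card (pverts G) = 10" by (rule D(1,2))+
    show "?N v \<subseteq> pverts G" "card (?N v) = 3" if "v \<in> pverts G" for v
      using D(4,6) that by auto
    show "u \<in> ?N v" if "v \<in> ?N u" for u v using D(7) that by auto
    show "v \<notin> ?N v" for v using D(8) by auto
  qed (use tri sq in blast)+
  show ?thesis
  proof (rule digraph_isoI[OF P[unfolded cubic_graphs_10_def] G[unfolded cubic_graphs_10_def]])
    show "bij_betw f (pverts petersen) (pverts G)" using f(1) by (simp add: petersen_def)
    show "(f u, f v) \<in> parcs G" if "(u, v) \<in> parcs petersen" for u v
      using that f(2) D(7) by (auto simp: petersen_def)
  qed
qed

theorem theorem2p5:
  shows
    "(petersen \<in> cubic_graphs_10) \<and>
     (\<not> energy_unique cubic_graphs_10 petersen) \<and>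
     (\<not> randic_energy_unique cubic_graphs_10 petersen) \<and>
     (energy petersen = 16) \<and>
     (\<exists>H\<in>cubic_graphs_10. \<not> digraph_iso (with_proj petersen) (with_proj H) \<and> energy H = 16) \<and>
     (\<forall>G\<in>cubic_graphs_10. energy G \<le> energy petersen) \<and>
     (\<forall>G\<in>cubic_graphs_10. randic_energy G \<le> randic_energy petersen) \<and>
     (adjacency_spectrum petersen =
           replicate_mset 1 3 + replicate_mset 5 1 + replicate_mset 4 (-2)) \<and>
     (\<forall>G\<in>cubic_graphs_10.
           energy G = energy petersen \<and> adjacency_spectrum G = adjacency_spectrum petersen
             \<longrightarrow> digraph_iso (with_proj petersen) (with_proj G)) \<and>
     (\<forall>G\<in>cubic_graphs_10.
           randic_energy G = randic_energy petersen \<and>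
           adjacency_spectrum G = adjacency_spectrum petersen
             \<longrightarrow> digraph_iso (with_proj petersen) (with_proj G))"
proof -
  let ?R = "replicate_mset 1 3 + replicate_mset 5 1 + replicate_mset 4 (-2) :: real multiset"
  let ?H = "list_graph mate_nbrs"
  have P: "petersen \<in> cubic_graphs_10" and H: "?H \<in> cubic_graphs_10"
    unfolding petersen_list using petersen_mate_checks by (auto intro: list_graph_cubic)
  have spectrum: "adjacency_spectrum G = ?R \<longleftrightarrow> cubic10.w (adj G) = 0 \<and>
      (\<Sum>i<10. \<Sum>j<10. cubic10.d (adj G) i j * adj G j i) = 0" if "G \<in> cubic_graphs_10" for G
    unfolding adjacency_spectrum_def eigenvalue_mset_def adjacency_matrix_eq[OF that]
    by (rule cubic10.petersen_spectrum_iff[OF cubic10_adj[OF that]])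
  have no_triangle: "codegree petersen_nbrs i j = 0" if "i < 10" "j \<in> set (petersen_nbrs ! i)" for i j
    using petersen_mate_checks(3) that unfolding trianglefree_list_def by blast
  have specP: "adjacency_spectrum petersen = ?R"
    unfolding spectrum[OF P]
  proof
    interpret cubic10 "adj petersen" using P by (rule cubic10_adj)
    show "w = 0" unfolding petersen_list by (rule list_graph_w[OF petersen_mate_checks(1,2)])
    show "(\<Sum>i<10. \<Sum>j<10. d i j * adj petersen j i) = 0"
      unfolding trace3_eq_0_iff unfolding petersen_list
      by (auto simp: d_list_graph[OF petersen_mate_checks(1)] adj_list_graph no_triangle split: if_splits)
  qed
  have EP: "energy petersen = 16"
    by (simp add: energy_def specP)
  have EH: "energy ?H = 16"
    by (rule energy_list_graph[OF petersen_mate_checks(4-6)])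
  have niso: "\<not> digraph_iso (with_proj petersen) (with_proj ?H)"
  proof
    assume iso: "digraph_iso (with_proj petersen) (with_proj ?H)"
    note D = regular_graphsD[OF P[unfolded cubic_graphs_10_def]]
    \<comment> \<open>A triangle of the second graph, which an isomorphism would pull back to the
      triangle-free Petersen graph.\<close>
    have "(0, 1) \<in> parcs ?H" "(1, 2) \<in> parcs ?H" "(0, 2) \<in> parcs ?H"
      by (auto simp: list_graph_def mate_nbrs_def)
    from digraph_iso_reflects_triangle[OF iso _ this] D(5,6)
    obtain u v w where uvw: "(u, v) \<in> parcs petersen" "(v, w) \<in> parcs petersen" "(u, w) \<in> parcs petersen"
      by metis
    then have "u < 10" "v \<in> set (petersen_nbrs ! u)" "w \<in> set (petersen_nbrs ! u)" "w \<in> set (petersen_nbrs ! v)"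
      unfolding petersen_list list_graph_def by auto
    then show False using no_triangle[of u v] by (auto simp: codegree_def filter_empty_conv)
  qed
  have le: "energy G \<le> 16" if "G \<in> cubic_graphs_10" for G
    using cubic10.E_le[OF cubic10_adj[OF that]] energy_eq[OF that] by simp
  have iso: "digraph_iso (with_proj petersen) (with_proj G)"
    if "G \<in> cubic_graphs_10" "adjacency_spectrum G = adjacency_spectrum petersen" for G
    using petersen_spectrum_imp_iso[OF P that(1)] spectrum[OF that(1)] that(2) specP by simp
  show ?thesis
    using P H EP EH niso le iso specP
    by (auto simp: energy_unique_def randic_energy_unique_def randic_energy_cubic)
qed

end
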